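(* The monotone adaptive walk (MAW) on $\mathbb{Z}^2$ is transient: almost surely it visits every vertex of $\mathbb{Z}^2$ only finitely many times.
   Context: The MAW is the following nearest-neighbour process $(X_t)_{t\ge0}$ on $\mathbb{Z}^2$ with $X_0=(0,0)$, performed in a changing environment of conductances on the edges of $\mathbb{Z}^2$. Initially horizontal edges have conductance $1$ and vertical edges have conductance $2$. Whenever the walk is at a vertex, before its next step the conductance of the edge from that vertex to its right neighbour is set to $2$ (if it was not already $2$); conductances never change otherwise. Thus the conductance used for the step at time $t$ is $C_t(e)=2$ if $e$ is vertical or $e=\{X_s,X_s+(1,0)\}$ for some $0\le s\le t$, and $C_t(e)=1$ otherwise. Given the history up to time $t$, the walk jumps from $X_t$ to a neighbour $v$ with probability $C_t(X_t,v)/\sum_{e\ni X_t}C_t(e)$. Equivalently: if the left neighbour $X_t-(1,0)$ has not been visited before time $t$, the walk steps left with probability $1/7$ and in each of the other three directions with probability $2/7$; otherwise it steps in each of the four directions with probability $1/4$. *)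

theory Defs
  imports "HOL-Probability.Probability"
begin

type_synonym vertex = "int \<times> int"

definition vertical_edges :: "vertex set set" where
  "vertical_edges = {{v, v + (0, 1)} | v. True}"

definition horizontal_edges :: "vertex set set" where
  "horizontal_edges = {{v, v + (1, 0)} | v. True}"

definition lattice_edges :: "vertex set set" where
  "lattice_edges = vertical_edges \<union> horizontal_edges"

text \<open>
  \<open>conductance x t e\<close> is $C_t(e)$ when the walk has followed the trajectory \<open>x\<close>. It depends only on
  \<open>x 0, \<dots>, x t\<close>; the bound \<open>s \<le> t\<close> includes the current vertex, whose right edge is reinforced
  before the step is taken.
\<close>

definition conductance :: "(nat \<Rightarrow> vertex) \<Rightarrow> nat \<Rightarrow> vertex set \<Rightarrow> real" where
  "conductance x t e =
    (if e \<in> vertical_edges \<or> (\<exists>s\<le>t. e = {x s, x s + (1, 0)}) then 2 else 1)"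

definition step_prob :: "(nat \<Rightarrow> vertex) \<Rightarrow> nat \<Rightarrow> vertex \<Rightarrow> real" where
  "step_prob x t v =
    (if {x t, v} \<in> lattice_edges
     then conductance x t {x t, v} / (\<Sum>e\<in>{e \<in> lattice_edges. x t \<in> e}. conductance x t e)
     else 0)"

text \<open>
  Since \<open>vertex\<close> is countable, the conditional law of the next step given the history is determined
  by conditioning on the elementary events of positive probability that fix \<open>X 0, \<dots>, X t\<close>.
\<close>

locale monotone_adaptive_walk = prob_space M for M :: "'a measure" +
  fixes X :: "nat \<Rightarrow> 'a \<Rightarrow> vertex"
  assumes measurable_X: "\<And>t. X t \<in> measurable M (count_space UNIV)"
    and start: "AE \<omega> in M. X 0 \<omega> = (0, 0)"
    and transition: "\<And>x t v. \<P>(\<omega> in M. \<forall>s\<le>t. X s \<omega> = x s) > 0 \<Longrightarrow>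
      \<P>(\<omega> in M. X (Suc t) \<omega> = v \<bar> \<forall>s\<le>t. X s \<omega> = x s) = step_prob x t v"

end

(*
  Run the walk lazily: at each time pick one of the four directions uniformly, but reject a left step
  with probability 1/2 if the left neighbour is unvisited.  The jump chain of this lazy walk is the
  MAW, and its position is S_t + (R_t, 0), where S is a simple random walk and R_t is the number of
  rejections so far.  As R is nondecreasing, the left neighbour is certainly unvisited whenever S
  stands at least two units to the right of all its earlier visits to its current row.  In every row,
  the number of such record times is polynomially large in n, except with polynomially small
  probability: the probability that S reaches distance r before the next such record decays like a power
  of r, by a multiscale argument.  Since S visits about sqrt n rows up to time n, R_n exceeds n to
  some power > 1/2 with probability tending to 1 polynomially fast, which beats the fluctuations of
  the horizontal coordinate of S along a geometric sequence of times.
*)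
theory Submission
  imports Defs "HOL-Library.Sublist"
begin

section \<open>Random words\<close>

text \<open>The step law of the MAW depends on its past. Splitting the left step into
  \<open>Lt\<close> and \<open>Lr\<close> moves this dependence out of the randomness: the moves are
  independent, and the past only decides whether an \<open>Lr\<close> takes effect. All estimates
  thus concern the simple random walk \<open>disp\<close>, on finite words, where expectations are
  iterated averages. The difficulty is quantitative. The decay exponent obtained from the scales is
  tiny, and a row is useful only when it is much closer to the start than the box radius, which
  costs a power of the radius in the number of rows. Taking the radius \<open>160 ^ (N * s)\<close>
  with \<open>N\<close> large compared with \<open>p\<close> reduces this cost to 160^(p s), and the
  number of scores asked of each row exceeds it by 160^(3 s). Up to constants, the rejections then
  beat the square root of the time by the factor 160^(2 s).\<close>

text \<open>The moves other than \<open>Lt\<close> and \<open>Lr\<close> have weight $1/4$; these two have weight $1/8$ each, and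
  \<open>Lr\<close> is the left step that is rejected when the left neighbour is unvisited.
  Words of moves list the most recent move first, so that the past is a suffix.\<close>

datatype move = Rt | Up | Dn | Lt | Lr

fun dir :: "move \<Rightarrow> vertex" where
  "dir Rt = (1, 0)" | "dir Up = (0, 1)" | "dir Dn = (0, -1)" | "dir Lt = (-1, 0)" | "dir Lr = (-1, 0)"

definition avg :: "(move \<Rightarrow> real) \<Rightarrow> real" where
  "avg f = (2 * f Rt + 2 * f Up + 2 * f Dn + f Lt + f Lr) / 8"

text \<open>The innermost average is over the most recent move, so
  \<open>avg (\<lambda>a. f (a # l))\<close> is the conditional expectation given the past
  \<open>l\<close>.\<close>

primrec mean :: "nat \<Rightarrow> (move list \<Rightarrow> real) \<Rightarrow> real" where
  "mean 0 f = f []"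
| "mean (Suc t) f = mean t (\<lambda>l. avg (\<lambda>a. f (a # l)))"

abbreviation pr :: "nat \<Rightarrow> (move list \<Rightarrow> bool) \<Rightarrow> real" where
  "pr t Q \<equiv> mean t (\<lambda>l. of_bool (Q l))"

lemma avg_const [simp]: "avg (\<lambda>_. c) = c"
  by (simp add: avg_def)

lemma avg_mono: "(\<And>a. f a \<le> g a) \<Longrightarrow> avg f \<le> avg g"
  unfolding avg_def by (intro divide_right_mono add_mono mult_left_mono) auto

lemma avg_add: "avg (\<lambda>a. f a + g a) = avg f + avg g"
  by (simp add: avg_def field_simps)

lemma avg_cmult: "avg (\<lambda>a. c * f a) = c * avg f"
  by (simp add: avg_def field_simps)

lemma mean_mono:
  "(\<And>l. length l = t \<Longrightarrow> f l \<le> g l) \<Longrightarrow> mean t f \<le> mean t g"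
proof (induction t arbitrary: f g)
  case (Suc t)
  then show ?case by (auto intro!: Suc.IH avg_mono)
qed simp

lemma mean_const [simp]: "mean t (\<lambda>_. c) = c"
  by (induction t) auto

lemma mean_add: "mean t (\<lambda>l. f l + g l) = mean t f + mean t g"
  by (induction t arbitrary: f g) (auto simp: avg_add)

lemma mean_cmult: "mean t (\<lambda>l. c * f l) = c * mean t f"
  by (induction t arbitrary: f) (auto simp: avg_cmult)

lemma mean_sum: "mean t (\<lambda>l. \<Sum>i\<in>I. f i l) = (\<Sum>i\<in>I. mean t (f i))"
  by (induction I rule: infinite_finite_induct) (auto simp: mean_add)

lemma mean_nonneg: "(\<And>l. length l = t \<Longrightarrow> 0 \<le> f l) \<Longrightarrow> 0 \<le> mean t f"
  using mean_mono[of t "\<lambda>_. 0" f] by simp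

lemma pr_le_1: "pr t Q \<le> 1"
  using mean_mono[of t "\<lambda>l. of_bool (Q l)" "\<lambda>_. 1"] by simp

lemma pr_mono: "(\<And>l. length l = t \<Longrightarrow> Q l \<Longrightarrow> Q' l) \<Longrightarrow> pr t Q \<le> pr t Q'"
  by (rule mean_mono) auto

lemma pr_disj: "pr t (\<lambda>l. Q l \<or> Q' l) \<le> pr t Q + pr t Q'"
  unfolding mean_add[symmetric] by (rule mean_mono) auto

lemma pr_bex:
  assumes "finite I"
  shows "pr t (\<lambda>l. \<exists>i\<in>I. Q i l) \<le> (\<Sum>i\<in>I. pr t (Q i))"
  unfolding mean_sum[symmetric]
proof (rule mean_mono)
  fix l :: "move list"
  show "of_bool (\<exists>i\<in>I. Q i l) \<le> (\<Sum>i\<in>I. of_bool (Q i l) :: real)"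
  proof (cases "\<exists>i\<in>I. Q i l")
    case True
    then obtain i where "i \<in> I" "Q i l" by blast
    then show ?thesis
      using member_le_sum[of i I "\<lambda>i. of_bool (Q i l) :: real"] assms by auto
  qed (auto intro: sum_nonneg)
qed

lemma mean_drop: "mean (t + k) (\<lambda>l. f (drop k l)) = mean t f"
  by (induction k arbitrary: f) auto

text \<open>Stopping times are built into \<Psi>, which is made not to increase once the walk has
  stopped; the one-step inequality then replaces optional stopping.\<close>

lemma mean_supermartingale:
  assumes "\<And>l. length l < t \<Longrightarrow> avg (\<lambda>a. \<Psi> (a # l)) \<le> \<Psi> l"
  shows "mean t \<Psi> \<le> \<Psi> []"
  using assms
proof (induction t)
  case (Suc t)
  have "mean (Suc t) \<Psi> \<le> mean t \<Psi>"
    using Suc.prems by (auto intro!: mean_mono)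
  also have "\<dots> \<le> \<Psi> []"
    using Suc by simp
  finally show ?case .
qed simp

section \<open>Simple random walk: maximal inequality and exit from a strip\<close>

fun disp :: "move list \<Rightarrow> vertex" where
  "disp [] = (0, 0)"
| "disp (a # l) = disp l + dir a"

fun escaped :: "real \<Rightarrow> move list \<Rightarrow> bool" where
  "escaped c [] = (\<bar>real_of_int (fst (disp []))\<bar> \<ge> c)"
| "escaped c (a # l) = (escaped c l \<or> \<bar>real_of_int (fst (disp (a # l)))\<bar> \<ge> c)"

lemma escaped_iff: "escaped c l \<longleftrightarrow> (\<exists>l'. suffix l' l \<and> \<bar>real_of_int (fst (disp l'))\<bar> \<ge> c)"
  by (induction l) (auto simp: suffix_Cons)

text \<open>Kolmogorov's maximal inequality: a move is horizontal with probability 1/2, so x^2 - n/2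
  is a martingale, and \<Psi> freezes at 1 on the first escape.\<close>

lemma pr_escaped:
  assumes "c > 0"
  shows "pr t (escaped c) \<le> real t / (2 * c\<^sup>2)"
proof -
  define \<Psi> where "\<Psi> l = (if escaped c l then 1 else
     ((real_of_int (fst (disp l)))\<^sup>2 + (real t - real (length l)) / 2) / c\<^sup>2)" for l
  have hit: "1 \<le> x\<^sup>2 / c\<^sup>2" if "\<bar>x\<bar> \<ge> c" for x :: real
    using that assms by (simp add: abs_le_square_iff[symmetric])
  have "pr t (escaped c) \<le> mean t \<Psi>"
    by (rule mean_mono) (auto simp: \<Psi>_def)
  also have "\<dots> \<le> \<Psi> []"
  proof (rule mean_supermartingale)
    fix l :: "move list"
    assume len: "length l < t"
    show "avg (\<lambda>a. \<Psi> (a # l)) \<le> \<Psi> l"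
    proof (cases "escaped c l")
      case True
      then show ?thesis by (simp add: \<Psi>_def)
    next
      case False
      let ?x = "real_of_int (fst (disp l))"
      have "\<Psi> (a # l) \<le> ((real_of_int (fst (disp (a # l))))\<^sup>2 + (real t - (real (length l) + 1)) / 2) / c\<^sup>2" for a
      proof (cases "escaped c (a # l)")
        case True
        with False have "1 \<le> (real_of_int (fst (disp (a # l))))\<^sup>2 / c\<^sup>2"
          by (intro hit) simp
        also have "\<dots> \<le> ((real_of_int (fst (disp (a # l))))\<^sup>2 + (real t - (real (length l) + 1)) / 2) / c\<^sup>2"
          using len by (intro divide_right_mono) auto
        finally show ?thesis using True by (simp add: \<Psi>_def)
      qed (simp add: \<Psi>_def algebra_simps)
      then have "avg (\<lambda>a. \<Psi> (a # l)) \<le> avg (\<lambda>a. ((real_of_int (fst (disp (a # l))))\<^sup>2 + (real t - (real (length l) + 1)) / 2) / c\<^sup>2)"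
        by (rule avg_mono)
      also have "\<dots> = (?x\<^sup>2 + (real t - real (length l)) / 2) / c\<^sup>2"
        using assms by (simp add: avg_def divide_simps) (simp add: power2_eq_square algebra_simps)
      finally show ?thesis using False by (simp add: \<Psi>_def)
    qed
  qed
  also have "\<dots> = real t / (2 * c\<^sup>2)"
    using assms by (simp add: \<Psi>_def)
  finally show ?thesis .
qed

fun confined :: "int \<Rightarrow> move list \<Rightarrow> bool" where
  "confined r [] = True"
| "confined r (a # l) = (confined r l \<and> \<bar>snd (disp (a # l))\<bar> \<le> r)"

text \<open>Markov's inequality for the exit time of the strip, whose mean is at most 2 (r + 1)^2
  because y^2 - n/2 is a martingale.\<close>

lemma pr_confined:
  assumes "r \<ge> 0"
  shows "real t * pr t (confined r) \<le> 2 * (real_of_int r + 1)\<^sup>2"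
proof -
  define \<Psi> where "\<Psi> l = (if confined r l then
     (real_of_int r + 1)\<^sup>2 - (real_of_int (snd (disp l)))\<^sup>2 + real (length l) / 2 else 0)" for l
  \<comment> \<open>The bound r + 1 admits the first position outside the strip, where the
    expression that dominates \<Psi> must still be nonnegative.\<close>
  have in_strip: "(real_of_int y)\<^sup>2 \<le> (real_of_int r + 1)\<^sup>2" if "\<bar>y\<bar> \<le> r + 1" for y :: int
  proof -
    have "\<bar>real_of_int y\<bar> \<le> \<bar>real_of_int r + 1\<bar>" using that assms by linarith
    then show ?thesis by (simp add: abs_le_square_iff)
  qed
  have conf: "\<bar>snd (disp l)\<bar> \<le> r" if "confined r l" for l
    using that assms by (cases l) auto
  have "(real t / 2) * pr t (confined r) \<le> mean t \<Psi>"
    unfolding mean_cmult[symmetric]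
  proof (rule mean_mono)
    fix l :: "move list" assume "length l = t"
    then show "real t / 2 * of_bool (confined r l) \<le> \<Psi> l"
      using in_strip[of "snd (disp l)"] conf[of l] by (auto simp: \<Psi>_def)
  qed
  also have "\<dots> \<le> \<Psi> []"
  proof (rule mean_supermartingale)
    fix l :: "move list"
    show "avg (\<lambda>a. \<Psi> (a # l)) \<le> \<Psi> l"
    proof (cases "confined r l")
      case False
      then show ?thesis by (simp add: \<Psi>_def)
    next
      case True
      have "\<Psi> (a # l) \<le> (real_of_int r + 1)\<^sup>2 - (real_of_int (snd (disp (a # l))))\<^sup>2 + (real (length l) + 1) / 2" for a
      proof -
        have "\<bar>snd (disp (a # l))\<bar> \<le> r + 1"
          using conf[OF True] by (cases a) auto
        from in_strip[OF this] show ?thesis by (auto simp: \<Psi>_def)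
      qed
      then have "avg (\<lambda>a. \<Psi> (a # l)) \<le> avg (\<lambda>a. (real_of_int r + 1)\<^sup>2 - (real_of_int (snd (disp (a # l))))\<^sup>2 + (real (length l) + 1) / 2)"
        by (rule avg_mono)
      also have "\<dots> = \<Psi> l"
        using True by (simp add: avg_def \<Psi>_def) (simp add: power2_eq_square algebra_simps)
      finally show ?thesis .
    qed
  qed
  also have "\<dots> = (real_of_int r + 1)\<^sup>2" by (simp add: \<Psi>_def)
  finally show ?thesis by simp
qed

section \<open>Superharmonic functions for the record chain\<close>

text \<open>A vertex here is the position of the simple random walk relative to the rightmost earlier visit
  to a fixed row; \<open>base\<close> recentres at a new record, and \<open>scores\<close> is a rejection at a record
  with a gap of at least 2. A \<open>superharmonic r\<close> function dominates the probability of leaving the box of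
  radius \<open>r\<close> before scoring.\<close>

definition inbox :: "int \<Rightarrow> vertex \<Rightarrow> bool" where
  "inbox r z \<longleftrightarrow> \<bar>fst z\<bar> \<le> r \<and> \<bar>snd z\<bar> \<le> r"

definition base :: "vertex \<Rightarrow> vertex" where
  "base z = (if snd z = 0 \<and> fst z > 0 then (0, 0) else z)"

definition scores :: "vertex \<Rightarrow> move \<Rightarrow> bool" where
  "scores z a \<longleftrightarrow> a = Lr \<and> snd z = 0 \<and> fst z \<ge> 2"

definition superharmonic :: "int \<Rightarrow> (vertex \<Rightarrow> real) \<Rightarrow> bool" where
  "superharmonic r f \<longleftrightarrow>
    (\<forall>z. 0 \<le> f z \<and> f z \<le> 1) \<and> (\<forall>z. \<not> inbox r z \<longrightarrow> f z = 1) \<and>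
    (\<forall>z. inbox r z \<longrightarrow> avg (\<lambda>a. if scores z a then 0 else f (base z + dir a)) \<le> f z)"

lemma superharmonicD:
  assumes "superharmonic r f"
  shows "0 \<le> f z" "f z \<le> 1" "\<not> inbox r z \<Longrightarrow> f z = 1"
    "inbox r z \<Longrightarrow> avg (\<lambda>a. if scores z a then 0 else f (base z + dir a)) \<le> f z"
  using assms unfolding superharmonic_def by blast+

lemma inbox_step: "inbox r z \<Longrightarrow> inbox (r + 1) (base z + dir a)"
  by (cases a) (auto simp: inbox_def base_def)

section \<open>Discrete potential theory: a subharmonic barrier off the positive half-line\<close>

text \<open>The maximum of \<open>lens\<close>, \<open>wedge\<close> and 0 is a lower bound for the probability that a simple random walk
  starting in the box of radius \<open>\<rho>\<close> hits the positive half-line of the row before leaving the box of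
  radius \<open>80 * \<rho>\<close>. The \<open>wedge\<close> is $\mathrm{Re}\,z^4$, positive in a cone of opening $\pi/4$; it leads the walk
  far to the right, into the square tilted by 45 degrees where the \<open>lens\<close> is positive.\<close>

definition lens :: "real \<Rightarrow> real \<Rightarrow> real \<Rightarrow> real" where
  "lens \<rho> x y = ((40 * \<rho> - \<bar>y\<bar>)\<^sup>2 - (x - 40 * \<rho>)\<^sup>2) / (40 * \<rho>)\<^sup>2"

definition wedge :: "real \<Rightarrow> real \<Rightarrow> real \<Rightarrow> real" where
  "wedge \<rho> x y = ((x + 4 * \<rho>) ^ 4 - 6 * (x + 4 * \<rho>)\<^sup>2 * y\<^sup>2 + y ^ 4) / (20000000 * \<rho> ^ 4)"

text \<open>The polynomials are also positive elsewhere: the quadratic beyond |y| = 40 \<rho>, the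
  quartic in three more cones. The truncations remove these regions. \<open>wedge'\<close> also
  stops after x = 40 \<rho>, a line on which \<open>lens'\<close> is at least as large wherever
  \<open>wedge'\<close> is positive.\<close>

definition lens' :: "real \<Rightarrow> real \<Rightarrow> real \<Rightarrow> real" where
  "lens' \<rho> x y = (if \<bar>y\<bar> \<le> 40 * \<rho> then lens \<rho> x y else 0)"

definition wedge' :: "real \<Rightarrow> real \<Rightarrow> real \<Rightarrow> real" where
  "wedge' \<rho> x y = (if \<bar>y\<bar> \<le> x + 4 * \<rho> \<and> x \<le> 40 * \<rho> then wedge \<rho> x y else 0)"

definition \<phi> :: "real \<Rightarrow> real \<Rightarrow> real \<Rightarrow> real" where
  "\<phi> \<rho> x y = max 0 (max (lens' \<rho> x y) (wedge' \<rho> x y))"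

text \<open>On either side of row 0 the numerator is y^2 - x^2 plus an affine function, hence
  harmonic; |y| >= 1 keeps all four neighbours on one side of the kink of |y|.\<close>

lemma lens_harmonic:
  assumes "\<bar>y\<bar> \<ge> 1" "\<rho> > 0"
  shows "4 * lens \<rho> x y = lens \<rho> (x + 1) y + lens \<rho> (x - 1) y + lens \<rho> x (y + 1) + lens \<rho> x (y - 1)"
proof -
  have *: "lens \<rho> (x + 1) y + lens \<rho> (x - 1) y + lens \<rho> x (y + 1) + lens \<rho> x (y - 1) - 4 * lens \<rho> x y =
    (2 * (40 * \<rho> - \<bar>y\<bar>)\<^sup>2 - (x + 1 - 40 * \<rho>)\<^sup>2 - (x - 1 - 40 * \<rho>)\<^sup>2 + (40 * \<rho> - \<bar>y + 1\<bar>)\<^sup>2 + (40 * \<rho> - \<bar>y - 1\<bar>)\<^sup>2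
       - 2 * (x - 40 * \<rho>)\<^sup>2 - 4 * (40 * \<rho> - \<bar>y\<bar>)\<^sup>2 + 4 * (x - 40 * \<rho>)\<^sup>2) / (40 * \<rho>)\<^sup>2"
    unfolding lens_def by (simp add: diff_divide_distrib add_divide_distrib)
  consider "y \<ge> 1" | "y \<le> -1" using assms by linarith
  then have "2 * (40 * \<rho> - \<bar>y\<bar>)\<^sup>2 - (x + 1 - 40 * \<rho>)\<^sup>2 - (x - 1 - 40 * \<rho>)\<^sup>2 + (40 * \<rho> - \<bar>y + 1\<bar>)\<^sup>2 + (40 * \<rho> - \<bar>y - 1\<bar>)\<^sup>2
       - 2 * (x - 40 * \<rho>)\<^sup>2 - 4 * (40 * \<rho> - \<bar>y\<bar>)\<^sup>2 + 4 * (x - 40 * \<rho>)\<^sup>2 = 0"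
    by cases (auto simp: power2_eq_square algebra_simps)
  with * show ?thesis by simp
qed

text \<open>In the discrete Laplacian of Re z^4 the second-order terms cancel and the fourth-order
  terms leave the constant 4.\<close>

lemma wedge_subharmonic:
  assumes "\<rho> > 0"
  shows "4 * wedge \<rho> x y \<le> wedge \<rho> (x + 1) y + wedge \<rho> (x - 1) y + wedge \<rho> x (y + 1) + wedge \<rho> x (y - 1)"
proof -
  define X where "X = x + 4 * \<rho>"
  have X: "x + 1 + 4 * \<rho> = X + 1" "x - 1 + 4 * \<rho> = X - 1" "x + 4 * \<rho> = X"
    by (auto simp: X_def)
  have "wedge \<rho> (x + 1) y + wedge \<rho> (x - 1) y + wedge \<rho> x (y + 1) + wedge \<rho> x (y - 1) - 4 * wedge \<rho> x y
    = 4 / (20000000 * \<rho> ^ 4)"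
    using assms unfolding wedge_def X
    by (simp add: divide_simps) (simp add: power2_eq_square power4_eq_xxxx algebra_simps)
  also have "\<dots> \<ge> 0" using assms by simp
  finally show ?thesis by simp
qed

lemma quartic_eq:
  fixes X y :: real
  shows "X ^ 4 - 6 * X\<^sup>2 * y\<^sup>2 + y ^ 4 = (X\<^sup>2 - y\<^sup>2)\<^sup>2 - 4 * X\<^sup>2 * y\<^sup>2"
    and "X ^ 4 - 6 * X\<^sup>2 * y\<^sup>2 + y ^ 4 = (X\<^sup>2 - 3 * y\<^sup>2)\<^sup>2 - 8 * y ^ 4"
  by (simp_all add: power2_eq_square power4_eq_xxxx algebra_simps)

text \<open>Within |y| <= X, Re z^4 is positive only for angles below \<pi>/8, and tan(\<pi>/8) <
  1/2. The gap up to the truncation |y| <= X leaves room for one lattice step.\<close>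

lemma quartic_pos_imp:
  fixes X y :: real
  assumes "X ^ 4 - 6 * X\<^sup>2 * y\<^sup>2 + y ^ 4 > 0" "\<bar>y\<bar> \<le> X"
  shows "2 * \<bar>y\<bar> < X"
proof (rule ccontr)
  assume "\<not> ?thesis"
  then have *: "X \<le> 2 * \<bar>y\<bar>" by simp
  have "y\<^sup>2 \<le> X\<^sup>2" using assms(2) by (intro abs_le_square_iff[THEN iffD1]) auto
  moreover have "X\<^sup>2 \<le> 4 * y\<^sup>2"
    using power_mono[OF *, of 2] assms(2) by (simp add: power_mult_distrib)
  ultimately have "0 \<le> X\<^sup>2 - y\<^sup>2" "X\<^sup>2 - y\<^sup>2 \<le> X\<^sup>2" by auto
  then have "(X\<^sup>2 - y\<^sup>2)\<^sup>2 \<le> (X\<^sup>2)\<^sup>2" by (intro power_mono) auto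
  also have "\<dots> = X\<^sup>2 * X\<^sup>2" by (simp add: power2_eq_square)
  also have "\<dots> \<le> X\<^sup>2 * (4 * y\<^sup>2)" using \<open>X\<^sup>2 \<le> 4 * y\<^sup>2\<close> by (intro mult_left_mono) auto
  finally show False using assms(1) unfolding quartic_eq(1) by simp
qed

lemma quartic_le:
  fixes X y :: real
  assumes "2 * \<bar>y\<bar> \<le> X"
  shows "X ^ 4 - 6 * X\<^sup>2 * y\<^sup>2 + y ^ 4 \<le> X ^ 4"
proof -
  have "y\<^sup>2 \<le> X\<^sup>2" using assms by (intro abs_le_square_iff[THEN iffD1]) auto
  then have "y\<^sup>2 * y\<^sup>2 \<le> X\<^sup>2 * y\<^sup>2" by (intro mult_right_mono) auto
  moreover have "0 \<le> X\<^sup>2 * y\<^sup>2" by simp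
  moreover have "y ^ 4 = y\<^sup>2 * y\<^sup>2" by (simp add: power2_eq_square power4_eq_xxxx)
  ultimately show ?thesis by linarith
qed

lemma wedge_cases:
  assumes "wedge \<rho> x y > 0" "\<bar>y\<bar> \<le> x + 4 * \<rho>" "\<rho> > 0"
  shows "2 * \<bar>y\<bar> < x + 4 * \<rho>" and "wedge \<rho> x y \<le> (x + 4 * \<rho>) ^ 4 / (20000000 * \<rho> ^ 4)"
proof -
  have "0 < (x + 4 * \<rho>) ^ 4 - 6 * (x + 4 * \<rho>)\<^sup>2 * y\<^sup>2 + y ^ 4"
    using assms by (simp add: wedge_def zero_less_divide_iff)
  from quartic_pos_imp[OF this assms(2)] show *: "2 * \<bar>y\<bar> < x + 4 * \<rho>" .
  show "wedge \<rho> x y \<le> (x + 4 * \<rho>) ^ 4 / (20000000 * \<rho> ^ 4)"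
    unfolding wedge_def using * assms by (intro divide_right_mono quartic_le) auto
qed

text \<open>The normalisation 20000000 gives 44^4 / 20000000 < 1/5 < (18/40)^2, which keeps the
  wedge below the lens on the line x = 40 \<rho>.\<close>

lemma wedge'_le:
  assumes "\<rho> > 0" "wedge' \<rho> x y > 0"
  shows "wedge' \<rho> x y \<le> 1 / 5"
proof -
  have *: "\<bar>y\<bar> \<le> x + 4 * \<rho>" "x \<le> 40 * \<rho>" "wedge' \<rho> x y = wedge \<rho> x y"
    using assms by (auto simp: wedge'_def split: if_splits)
  have "(x + 4 * \<rho>) ^ 4 \<le> (44 * \<rho>) ^ 4"
    using * by (intro power_mono) auto
  then have "(x + 4 * \<rho>) ^ 4 / (20000000 * \<rho> ^ 4) \<le> (44 * \<rho>) ^ 4 / (20000000 * \<rho> ^ 4)"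
    using assms by (intro divide_right_mono) auto
  also have "\<dots> \<le> 1 / 5" using assms by (simp add: power_mult_distrib)
  finally have "(x + 4 * \<rho>) ^ 4 / (20000000 * \<rho> ^ 4) \<le> 1 / 5" .
  moreover have "wedge \<rho> x y \<le> (x + 4 * \<rho>) ^ 4 / (20000000 * \<rho> ^ 4)"
    using wedge_cases(2)[of \<rho> x y] assms * by simp
  ultimately show ?thesis unfolding *(3) by (rule order_trans[rotated])
qed

lemma lens'_le: "\<rho> > 0 \<Longrightarrow> lens' \<rho> x y \<le> 1"
proof -
  assume \<rho>: "\<rho> > 0"
  show ?thesis
  proof (cases "\<bar>y\<bar> \<le> 40 * \<rho>")
    case True
    then have "(40 * \<rho> - \<bar>y\<bar>)\<^sup>2 \<le> (40 * \<rho>)\<^sup>2" by (intro power_mono) auto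
    then have "(40 * \<rho> - \<bar>y\<bar>)\<^sup>2 - (x - 40 * \<rho>)\<^sup>2 \<le> (40 * \<rho>)\<^sup>2"
      by (smt (verit) zero_le_power2)
    then show ?thesis using \<rho> True by (simp add: lens'_def lens_def divide_le_eq)
  qed (simp add: lens'_def)
qed

lemma \<phi>_nonneg: "0 \<le> \<phi> \<rho> x y"
  by (simp add: \<phi>_def)

lemma \<phi>_le: "\<rho> > 0 \<Longrightarrow> \<phi> \<rho> x y \<le> 1"
  using lens'_le[of \<rho> x y] wedge'_le[of \<rho> x y] by (fastforce simp: \<phi>_def)

lemma lens_pos:
  assumes "lens' \<rho> x y > 0" "\<rho> > 0"
  shows "\<bar>x - 40 * \<rho>\<bar> < 40 * \<rho> - \<bar>y\<bar>" "lens' \<rho> x y = lens \<rho> x y"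
proof -
  have *: "\<bar>y\<bar> \<le> 40 * \<rho>" and eq: "lens' \<rho> x y = lens \<rho> x y"
    using assms by (auto simp: lens'_def split: if_splits)
  then have "lens \<rho> x y > 0" using assms by simp
  then have "(x - 40 * \<rho>)\<^sup>2 < (40 * \<rho> - \<bar>y\<bar>)\<^sup>2"
    using assms by (simp add: lens_def zero_less_divide_iff)
  then have "\<bar>x - 40 * \<rho>\<bar> < \<bar>40 * \<rho> - \<bar>y\<bar>\<bar>"
    using abs_le_square_iff not_less by metis
  then show "\<bar>x - 40 * \<rho>\<bar> < 40 * \<rho> - \<bar>y\<bar>" using * by simp
  show "lens' \<rho> x y = lens \<rho> x y" by (rule eq)
qed

lemma \<phi>_support:
  assumes "\<phi> \<rho> x y > 0" "\<rho> > 0"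
  shows "\<bar>x\<bar> \<le> 80 * \<rho>" "\<bar>y\<bar> \<le> 80 * \<rho>"
proof -
  have "lens' \<rho> x y > 0 \<or> wedge' \<rho> x y > 0" using assms by (auto simp: \<phi>_def)
  then have "\<bar>x\<bar> \<le> 80 * \<rho> \<and> \<bar>y\<bar> \<le> 80 * \<rho>"
  proof
    assume "lens' \<rho> x y > 0"
    from lens_pos(1)[OF this assms(2)] show ?thesis by linarith
  next
    assume "wedge' \<rho> x y > 0"
    then have "\<bar>y\<bar> \<le> x + 4 * \<rho> \<and> x \<le> 40 * \<rho>"
      by (auto simp: wedge'_def split: if_splits)
    then show ?thesis using assms(2) by linarith
  qed
  then show "\<bar>x\<bar> \<le> 80 * \<rho>" "\<bar>y\<bar> \<le> 80 * \<rho>" by auto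
qed

text \<open>Seen from the apex (-4 \<rho>, 0), the box has slope at most 1/3 < tan(\<pi>/8), so it
  lies inside the cone where the wedge is positive; this explains the shift by 4 \<rho>.\<close>

lemma \<phi>_lower:
  assumes "\<bar>x\<bar> \<le> \<rho>" "\<bar>y\<bar> \<le> \<rho>" "\<rho> > 0"
  shows "\<phi> \<rho> x y \<ge> 1 / 1000000"
proof -
  have y: "y\<^sup>2 \<le> \<rho>\<^sup>2" using power_mono[OF assms(2), of 2] by simp
  then have "(y\<^sup>2)\<^sup>2 \<le> (\<rho>\<^sup>2)\<^sup>2" by (rule power_mono) simp
  then have y4: "y ^ 4 \<le> \<rho> ^ 4" by simp
  have "(3 * \<rho>)\<^sup>2 \<le> (x + 4 * \<rho>)\<^sup>2" using assms by (intro power_mono) auto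
  then have "6 * \<rho>\<^sup>2 \<le> (x + 4 * \<rho>)\<^sup>2 - 3 * y\<^sup>2" using y by (simp add: power_mult_distrib)
  then have "(6 * \<rho>\<^sup>2)\<^sup>2 \<le> ((x + 4 * \<rho>)\<^sup>2 - 3 * y\<^sup>2)\<^sup>2" by (intro power_mono) auto
  then have "28 * \<rho> ^ 4 \<le> ((x + 4 * \<rho>)\<^sup>2 - 3 * y\<^sup>2)\<^sup>2 - 8 * y ^ 4"
    using y4 by (simp add: power_mult_distrib)
  then have "28 * \<rho> ^ 4 / (20000000 * \<rho> ^ 4) \<le> wedge \<rho> x y"
    unfolding wedge_def quartic_eq(2) using assms by (intro divide_right_mono) auto
  then have "1 / 1000000 \<le> wedge \<rho> x y" using assms by simp
  moreover have "wedge' \<rho> x y = wedge \<rho> x y" using assms by (auto simp: wedge'_def)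
  ultimately show ?thesis by (simp add: \<phi>_def)
qed

text \<open>A maximum of subharmonic functions is subharmonic. Only the truncations could spoil
  this, and at each of them the maximum is 0 or attained by the other function.\<close>

lemma \<phi>_subharmonic:
  fixes x y \<rho> :: int
  assumes \<rho>: "\<rho> > 0" and off: "y \<noteq> 0 \<or> x \<le> 0"
  shows "4 * \<phi> \<rho> x y \<le> \<phi> \<rho> (x + 1) y + \<phi> \<rho> (x - 1) y + \<phi> \<rho> x (y + 1) + \<phi> \<rho> x (y - 1)"
    (is "_ \<le> ?R")
proof -
  have \<rho>': "real_of_int \<rho> > 0" using \<rho> by simp
  have lens_case: ?thesis if L: "lens' \<rho> x y > 0" and eq: "\<phi> \<rho> x y = lens' \<rho> x y"
  proof -
    note p = lens_pos[OF L \<rho>']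
    \<comment> \<open>In row 0 the lens is positive only for x > 0, the half-line excluded by
      \<open>off\<close>, so the kink is avoided.\<close>
    have y0: "y \<noteq> 0"
    proof
      assume "y = 0"
      then have "real_of_int x \<le> 0" using off by simp
      then show False using p(1) \<open>y = 0\<close> by simp
    qed
    have "\<bar>y\<bar> < 40 * \<rho>" using p(1) by linarith
    then have yb: "\<bar>y\<bar> + 1 \<le> 40 * \<rho>" by simp
    have ge: "\<phi> \<rho> x' y' \<ge> lens \<rho> x' y'" if "\<bar>y'\<bar> \<le> \<bar>y\<bar> + 1" for x' y' :: int
    proof -
      have "\<bar>y'\<bar> \<le> 40 * \<rho>" using that yb by simp
      then have "\<bar>real_of_int y'\<bar> \<le> 40 * real_of_int \<rho>" by linarith
      then show ?thesis by (simp add: \<phi>_def lens'_def)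
    qed
    have yy: "\<bar>y + 1\<bar> \<le> \<bar>y\<bar> + 1" "\<bar>y - 1\<bar> \<le> \<bar>y\<bar> + 1" by arith+
    have "\<bar>real_of_int y\<bar> \<ge> 1" using y0 by linarith
    from lens_harmonic[OF this \<rho>', of x] show ?thesis
      using ge[of y "x + 1"] ge[of y "x - 1"] ge[OF yy(1), of x] ge[OF yy(2), of x] eq p(2) by simp
  qed
  show ?thesis
  proof (cases "\<phi> \<rho> x y = 0")
    case True
    then show ?thesis using \<phi>_nonneg by simp
  next
    case False
    show ?thesis
    proof (cases "lens' \<rho> x y \<ge> wedge' \<rho> x y")
      case True
      then show ?thesis using False by (intro lens_case) (auto simp: \<phi>_def)
    next
      case le: False
      then have W: "wedge' \<rho> x y > 0" and eq: "\<phi> \<rho> x y = wedge' \<rho> x y"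
        using False by (auto simp: \<phi>_def max_def split: if_splits)
      have *: "\<bar>real_of_int y\<bar> \<le> x + 4 * \<rho>" "real_of_int x \<le> 40 * \<rho>" "wedge' \<rho> x y = wedge \<rho> x y"
        using W by (auto simp: wedge'_def split: if_splits)
      have y2: "2 * \<bar>real_of_int y\<bar> < x + 4 * \<rho>"
        using wedge_cases(1)[of \<rho> x y] W * \<rho>' by simp
      \<comment> \<open>On this line the lens is at least 1/5 wherever the wedge is positive, so the
        wedge is not the strict maximum; hence the neighbour x + 1 stays in the range of the
        wedge.\<close>
      have "x \<noteq> 40 * \<rho>"
      proof
        assume x: "x = 40 * \<rho>"
        then have y22: "\<bar>real_of_int y\<bar> \<le> 22 * \<rho>" using y2 by simp
        then have "(18 * real_of_int \<rho>)\<^sup>2 \<le> (40 * \<rho> - \<bar>real_of_int y\<bar>)\<^sup>2"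
          using \<rho>' by (intro power_mono) auto
        then have "(18 * real_of_int \<rho>)\<^sup>2 / (40 * real_of_int \<rho>)\<^sup>2 \<le> lens \<rho> x y"
          unfolding lens_def x by (intro divide_right_mono) auto
        then have "1 / 5 \<le> lens \<rho> x y" using \<rho>' by (simp add: power_mult_distrib)
        moreover have "lens' \<rho> x y = lens \<rho> x y" using y22 \<rho>' by (simp add: lens'_def)
        ultimately show False using wedge'_le[OF \<rho>' W] le by simp
      qed
      then have x: "x + 1 \<le> 40 * \<rho>" using *(2) by linarith
      have "\<bar>y\<bar> < x + 4 * \<rho>" using y2 by linarith
      then have y: "\<bar>y\<bar> + 1 \<le> x + 4 * \<rho>" "\<bar>y + 1\<bar> \<le> x + 4 * \<rho>" "\<bar>y - 1\<bar> \<le> x + 4 * \<rho>" by arith+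
      have ge: "\<phi> \<rho> x' y' \<ge> wedge \<rho> x' y'" if "x' \<le> 40 * \<rho>" "\<bar>y'\<bar> \<le> x' + 4 * \<rho>" for x' y' :: int
      proof -
        have "real_of_int x' \<le> 40 * \<rho> \<and> \<bar>real_of_int y'\<bar> \<le> x' + 4 * \<rho>" using that by linarith
        then show ?thesis by (simp add: \<phi>_def wedge'_def)
      qed
      show ?thesis
        using wedge_subharmonic[OF \<rho>', of x y] eq *(3) x y
          ge[of "x + 1" y] ge[of "x - 1" y] ge[of x "y + 1"] ge[of x "y - 1"]
        by simp
    qed
  qed
qed

section \<open>Scoring before escaping: one scale, then all scales\<close>

lemma avg_ge_elem:
  assumes "\<And>a. 0 \<le> f a"
  shows "f a / (if a = Lt \<or> a = Lr then 8 else 4) \<le> avg f"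
  using assms[of Rt] assms[of Up] assms[of Dn] assms[of Lt] assms[of Lr]
  by (cases a) (simp_all add: avg_def)

text \<open>From a record, the moves \<open>Up, Rt, Rt, Dn, Lr\<close> produce a score; \<open>pattern\<close> gives the weight of
  the remaining part of this sequence.\<close>

definition pattern :: "vertex \<Rightarrow> real" where
  "pattern z =
    (if snd z = 0 \<and> fst z \<ge> 2 then 1 / 8 else if z = (2, 1) then 1 / 32
     else if z = (1, 1) then 1 / 128 else if z = (0, 1) then 1 / 512
     else if z = (1, 0) then 1 / 2048 else 0)"

text \<open>The factor 1/2048 is the weight of the whole pattern from (1, 0), and 1/1000000 is the
  lower bound of \<phi> on the inner box.\<close>

definition \<gamma> :: real where "\<gamma> = 1 / 2048000000"

text \<open>The walk hits the positive half-line with probability at least \<phi> and then completes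
  the pattern with probability at least 1/2048. The factor 160 accommodates the support radius 80 (r
  + 1) of \<phi>, as r >= 1.\<close>

lemma scale_function:
  fixes r :: int
  assumes r: "r \<ge> 1"
  shows "\<exists>F. superharmonic (160 * r) F \<and> (\<forall>z. inbox (r + 1) z \<longrightarrow> F z \<le> 1 - \<gamma>)"
proof -
  define \<rho> where "\<rho> = r + 1"
  have \<rho>: "\<rho> > 0" "real_of_int \<rho> > 0" "2 \<le> \<rho>" "80 * \<rho> \<le> 160 * r" using r by (auto simp: \<rho>_def)
  \<comment> \<open>Dividing by 2048 puts \<psi> below every nonzero value of
    \<open>pattern\<close>, in particular on the positive half-line, where \<phi> need not be
    subharmonic.\<close>
  define \<psi> where "\<psi> z = \<phi> \<rho> (fst z) (snd z) / 2048" for z :: vertex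
  define G0 where "G0 z = (if pattern z \<noteq> 0 then pattern z else \<psi> z)" for z
  define G where "G z = (if inbox (160 * r) z then G0 z else 0)" for z
  have \<psi>: "0 \<le> \<psi> z" "\<psi> z \<le> 1 / 2048" for z
    using \<phi>_nonneg \<phi>_le[OF \<rho>(2)] by (auto simp: \<psi>_def)
  have pat: "pattern z = 0 \<or> 1 / 2048 \<le> pattern z \<and> pattern z \<le> 1 / 8" for z
    by (auto simp: pattern_def)
  have G0: "0 \<le> G0 z" "G0 z \<le> 1" "\<psi> z \<le> G0 z" for z
    using pat[of z] \<psi>[of z] by (auto simp: G0_def)
  have G: "0 \<le> G z" "G z \<le> 1" for z
    using G0[of z] by (auto simp: G_def)
  have \<psi>G: "\<psi> z \<le> G z" for z
  proof (cases "inbox (160 * r) z")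
    case False
    have "\<psi> z = 0"
    proof (rule ccontr)
      assume "\<psi> z \<noteq> 0"
      then have "\<phi> \<rho> (fst z) (snd z) > 0" using \<phi>_nonneg[of \<rho> "fst z" "snd z"] by (auto simp: \<psi>_def)
      from \<phi>_support[OF this \<rho>(2)] have "\<bar>fst z\<bar> \<le> 80 * \<rho>" "\<bar>snd z\<bar> \<le> 80 * \<rho>" by linarith+
      then show False using False \<rho>(4) by (auto simp: inbox_def)
    qed
    then show ?thesis using G by simp
  qed (simp add: G_def G0)
  have in2: "inbox (160 * r) z" if "inbox 2 z" for z
    using that r by (auto simp: inbox_def)
  have vals: "G (2, 0) = 1 / 8" "G (2, 1) = 1 / 32" "G (1, 1) = 1 / 128" "G (0, 1) = 1 / 512" "G (1, 0) = 1 / 2048"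
    by (simp_all add: G_def in2 inbox_def[of 2] G0_def pattern_def)
  have sub: "G z \<le> avg (\<lambda>a. if scores z a then 1 else G (base z + dir a))" (is "_ \<le> avg ?h")
    if "inbox (160 * r) z" for z
  proof -
    have h: "0 \<le> ?h a" for a using G by simp
    have avg_ge: "avg ?h \<ge> ?h a / 4" if "a \<noteq> Lt" "a \<noteq> Lr" for a
      using avg_ge_elem[of ?h a] h that by (cases a) simp_all
    have avg_ge': "avg ?h \<ge> ?h Lr / 8"
      using avg_ge_elem[of ?h Lr] h by simp
    obtain x y where z: "z = (x, y)" by (cases z)
    consider "y = 0" "x \<ge> 2" | "z = (2, 1)" | "z = (1, 1)" | "z = (0, 1)" | "z = (1, 0)"
      | "pattern z = 0" "y \<noteq> 0 \<or> x \<le> 0"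
      by (fastforce simp: pattern_def z)
    then show ?thesis
    proof cases
      case 1
      then have "G z = 1 / 8" using that by (simp add: G_def G0_def pattern_def z)
      then show ?thesis using avg_ge' 1 by (simp add: scores_def z)
    next
      case 2
      then show ?thesis using avg_ge[of Dn] vals by (simp add: scores_def base_def)
    next
      case 3
      then show ?thesis using avg_ge[of Rt] vals by (simp add: scores_def base_def)
    next
      case 4
      then show ?thesis using avg_ge[of Rt] vals by (simp add: scores_def base_def)
    next
      case 5
      then show ?thesis using avg_ge[of Up] vals by (simp add: scores_def base_def)
    next
      case 6
      then have "G z = \<psi> z" using that by (simp add: G_def G0_def)
      also have "\<dots> \<le> avg (\<lambda>a. \<psi> (z + dir a))"
        using \<phi>_subharmonic[OF \<rho>(1) 6(2)] by (simp add: avg_def \<psi>_def z field_simps)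
      also have "\<dots> \<le> avg ?h"
        using 6 by (intro avg_mono) (auto simp: scores_def base_def z \<psi>G)
      finally show ?thesis .
    qed
  qed
  define F where "F z = 1 - G z" for z
  have "superharmonic (160 * r) F"
    unfolding superharmonic_def
  proof (intro conjI allI impI)
    fix z assume z: "inbox (160 * r) z"
    have "avg (\<lambda>a. if scores z a then 0 else F (base z + dir a)) =
      1 - avg (\<lambda>a. if scores z a then 1 else G (base z + dir a))"
      by (simp add: avg_def F_def scores_def field_simps)
    then show "avg (\<lambda>a. if scores z a then 0 else F (base z + dir a)) \<le> F z"
      using sub[OF z] by (simp add: F_def)
  qed (use G in \<open>auto simp: F_def G_def\<close>)
  moreover have "F z \<le> 1 - \<gamma>" if "inbox (r + 1) z" for z
  proof -
    have "\<bar>real_of_int (fst z)\<bar> \<le> \<rho>" "\<bar>real_of_int (snd z)\<bar> \<le> \<rho>"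
      using that unfolding inbox_def \<rho>_def by linarith+
    from \<phi>_lower[OF this \<rho>(2)] have "\<gamma> \<le> \<psi> z" by (simp add: \<psi>_def \<gamma>_def)
    then show ?thesis using \<psi>G[of z] by (simp add: F_def)
  qed
  ultimately show ?thesis by blast
qed

text \<open>Strong Markov property in the form of a minimum: surviving the inner box and then the
  outer one costs c times \<open>f\<close>. A step out of the inner box ends at most one unit
  outside, where \<open>f\<close> is 1; hence the bound on \<open>F\<close> is required up to radius
  r + 1.\<close>

lemma superharmonic_paste:
  assumes f: "superharmonic r f" and F: "superharmonic R F" and r: "r \<le> R"
    and c: "0 \<le> c" "c \<le> 1" and Fc: "\<And>z. inbox (r + 1) z \<Longrightarrow> F z \<le> c"
  shows "superharmonic R (\<lambda>z. if inbox r z then min (F z) (c * f z) else F z)" (is "superharmonic R ?g")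
proof -
  have gF: "?g z \<le> F z" for z by simp
  have gf: "?g z \<le> c * f z" if "inbox (r + 1) z" for z
  proof (cases "inbox r z")
    case False
    then have "f z = 1" using superharmonicD(3)[OF f] by simp
    then show ?thesis using Fc[OF that] False by simp
  qed simp
  have "avg (\<lambda>a. if scores z a then 0 else ?g (base z + dir a)) \<le> ?g z" if z: "inbox R z" for z
  proof -
    have 1: "avg (\<lambda>a. if scores z a then 0 else ?g (base z + dir a)) \<le> F z"
    proof (rule order_trans)
      show "avg (\<lambda>a. if scores z a then 0 else ?g (base z + dir a)) \<le> avg (\<lambda>a. if scores z a then 0 else F (base z + dir a))"
        by (rule avg_mono) (use gF in auto)
    qed (rule superharmonicD(4)[OF F z])
    have 2: "avg (\<lambda>a. if scores z a then 0 else ?g (base z + dir a)) \<le> c * f z" if zr: "inbox r z"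
    proof -
      have "avg (\<lambda>a. if scores z a then 0 else ?g (base z + dir a))
        \<le> avg (\<lambda>a. c * (if scores z a then 0 else f (base z + dir a)))"
        by (rule avg_mono) (use gf inbox_step[OF zr] in auto)
      also have "\<dots> = c * avg (\<lambda>a. if scores z a then 0 else f (base z + dir a))"
        by (rule avg_cmult)
      also have "\<dots> \<le> c * f z"
        using superharmonicD(4)[OF f zr] c by (intro mult_left_mono) auto
      finally show ?thesis .
    qed
    show ?thesis using 1 2 by simp
  qed
  moreover have "0 \<le> ?g z" "?g z \<le> 1" for z
    using superharmonicD(1,2)[OF f, of z] superharmonicD(1,2)[OF F, of z] c by (auto simp: min_le_iff_disj)
  moreover have "?g z = 1" if "\<not> inbox R z" for z
    using superharmonicD(3)[OF F that] that r by (auto simp: inbox_def)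
  ultimately show ?thesis unfolding superharmonic_def by blast
qed

text \<open>To get from radius 160^i to radius 160^J without a score, the walk must survive J - i
  scales, each with probability at most 1 - \<gamma>; this is a power law in the ratio of the
  radii.\<close>

lemma exists_superharmonic:
  "\<exists>f. superharmonic (160 ^ J) f \<and> (\<forall>i\<le>J. \<forall>z. inbox (160 ^ i) z \<longrightarrow> f z \<le> (1 - \<gamma>) ^ (J - i))"
proof (induction J)
  case 0
  show ?case
    by (rule exI[of _ "\<lambda>_. 1"]) (auto simp: superharmonic_def avg_def)
next
  case (Suc J)
  then obtain f where f: "superharmonic (160 ^ J) f"
    and fi: "\<And>i z. i \<le> J \<Longrightarrow> inbox (160 ^ i) z \<Longrightarrow> f z \<le> (1 - \<gamma>) ^ (J - i)" by blast
  obtain F where F: "superharmonic (160 * 160 ^ J) F" and Fc: "\<And>z. inbox (160 ^ J + 1) z \<Longrightarrow> F z \<le> 1 - \<gamma>"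
    using scale_function[of "160 ^ J"] by auto
  let ?g = "\<lambda>z. if inbox (160 ^ J) z then min (F z) ((1 - \<gamma>) * f z) else F z"
  have "superharmonic (160 ^ Suc J) ?g"
    using superharmonic_paste[OF f F _ _ _ Fc] by (simp add: \<gamma>_def)
  moreover have "?g z \<le> (1 - \<gamma>) ^ (Suc J - i)" if "i \<le> Suc J" "inbox (160 ^ i) z" for i z
  proof (cases "i = Suc J")
    case True
    have "?g z \<le> F z" by simp
    also have "F z \<le> 1" by (rule superharmonicD(2)[OF F])
    finally show ?thesis using True by simp
  next
    case False
    then have i: "i \<le> J" using that by simp
    have "inbox (160 ^ J) z"
      using that(2) power_increasing[OF i, of "160::int"] unfolding inbox_def by linarith
    then have "?g z \<le> (1 - \<gamma>) * f z" by simp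
    also have "\<dots> \<le> (1 - \<gamma>) * (1 - \<gamma>) ^ (J - i)"
      using fi[OF i that(2)] by (intro mult_left_mono) (auto simp: \<gamma>_def)
    finally show ?thesis using i by (simp add: Suc_diff_le)
  qed
  ultimately show ?case by blast
qed

section \<open>Scores in a row, and rejections\<close>

text \<open>\<open>rowmax y l\<close> ignores the current position, and starts from a fictitious visit at 0.\<close>

fun rowmax :: "int \<Rightarrow> move list \<Rightarrow> int" where
  "rowmax y [] = 0"
| "rowmax y (a # l) = (if snd (disp l) = y then max (rowmax y l) (fst (disp l)) else rowmax y l)"

definition rel :: "int \<Rightarrow> move list \<Rightarrow> vertex" where
  "rel y l = (fst (disp l) - rowmax y l, snd (disp l) - y)"

fun score :: "int \<Rightarrow> move list \<Rightarrow> nat" where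
  "score y [] = 0"
| "score y (a # l) = score y l + of_bool (scores (rel y l) a)"

fun strayed :: "int \<Rightarrow> int \<Rightarrow> move list \<Rightarrow> bool" where
  "strayed r y [] = (\<not> inbox r (rel y []))"
| "strayed r y (a # l) = (strayed r y l \<or> \<not> inbox r (rel y (a # l)))"

lemma rel_Cons: "rel y (a # l) = base (rel y l) + dir a"
  by (cases a) (auto simp: rel_def base_def prod_eq_iff)

lemma not_strayed: "\<not> strayed r y l \<Longrightarrow> inbox r (rel y l)"
  by (cases l) auto

lemma not_strayed_confined: "\<not> strayed r y l \<Longrightarrow> \<bar>y\<bar> \<le> r \<Longrightarrow> confined (2 * r) l"
  by (induction l) (auto simp: inbox_def rel_def)

text \<open>With fewer than m scores, the walk either never strays, hence stays in a strip, or
  strays from the start or after one of its scores. Each score resets the relative position to (-1,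
  0), so \<Psi> reserves \<open>f (-1, 0)\<close> for every score still missing.\<close>

lemma pr_score:
  assumes f: "superharmonic r f" and r: "r \<ge> 1" and y: "\<bar>y\<bar> \<le> r"
  shows "pr t (\<lambda>l. score y l < m) \<le> f (0, - y) + m * f (-1, 0) + pr t (confined (2 * r))"
proof -
  define q where "q = f (-1, 0)"
  note f0 = superharmonicD(1)[OF f] and f1 = superharmonicD(3)[OF f]
  have q: "0 \<le> q" using f0 by (simp add: q_def)
  define \<Psi> where "\<Psi> l = (if score y l \<ge> m then 0 else if strayed r y l then 1
      else f (rel y l) + (real m - real (score y l)) * q)" for l
  have nonneg: "0 \<le> \<Psi> l" for l using f0 q by (auto simp: \<Psi>_def)
  have "pr t (\<lambda>l. score y l < m) \<le> mean t (\<lambda>l. \<Psi> l + of_bool (confined (2 * r) l))"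
  proof (rule mean_mono)
    fix l
    show "of_bool (score y l < m) \<le> \<Psi> l + of_bool (confined (2 * r) l)"
    proof (cases "strayed r y l")
      case True
      then show ?thesis using nonneg[of l] by (auto simp: \<Psi>_def)
    next
      case False
      then show ?thesis using nonneg[of l] not_strayed_confined[OF False y] by auto
    qed
  qed
  also have "\<dots> = mean t \<Psi> + pr t (confined (2 * r))" by (rule mean_add)
  also have "mean t \<Psi> \<le> \<Psi> []"
  proof (rule mean_supermartingale)
    fix l
    show "avg (\<lambda>a. \<Psi> (a # l)) \<le> \<Psi> l"
    proof (cases "score y l \<ge> m \<or> strayed r y l")
      case True
      then have "\<Psi> (a # l) \<le> \<Psi> l" for a by (auto simp: \<Psi>_def)
      then have "avg (\<lambda>a. \<Psi> (a # l)) \<le> avg (\<lambda>a. \<Psi> l)" by (rule avg_mono)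
      then show ?thesis by simp
    next
      case False
      define c where "c = (real m - real (score y l)) * q"
      have c: "c \<ge> 0" "real (score y l) + 1 \<le> real m" using False q by (auto simp: c_def)
      have "\<Psi> (a # l) \<le> (if scores (rel y l) a then 0 else f (base (rel y l) + dir a)) + c" for a
      proof (cases "scores (rel y l) a")
        case True
        then have z: "rel y (a # l) = (-1, 0)" by (auto simp: rel_Cons scores_def base_def)
        then have "inbox r (rel y (a # l))" using r by (simp add: inbox_def)
        then have "\<Psi> (a # l) = (if score y l + 1 \<ge> m then 0 else q + (real m - real (score y l + 1)) * q)"
          using False True z by (auto simp: \<Psi>_def q_def)
        also have "\<dots> \<le> c" using c by (auto simp: c_def algebra_simps)
        finally show ?thesis using True by simp
      next
        case nos: False
        show ?thesis
        proof (cases "inbox r (rel y (a # l))")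
          case True
          then show ?thesis using nos False by (auto simp: \<Psi>_def c_def rel_Cons)
        next
          case out: False
          have "f (base (rel y l) + dir a) = 1"
            using f1[OF out] by (simp add: rel_Cons)
          then show ?thesis using nos False out c by (auto simp: \<Psi>_def)
        qed
      qed
      then have "avg (\<lambda>a. \<Psi> (a # l)) \<le> avg (\<lambda>a. (if scores (rel y l) a then 0 else f (base (rel y l) + dir a)) + c)"
        by (rule avg_mono)
      also have "\<dots> = avg (\<lambda>a. if scores (rel y l) a then 0 else f (base (rel y l) + dir a)) + c"
        by (simp add: avg_add)
      also have "\<dots> \<le> f (rel y l) + c"
        using superharmonicD(4)[OF f not_strayed] False by simp
      also have "\<dots> = \<Psi> l" using False by (simp add: \<Psi>_def c_def)
      finally show ?thesis .
    qed
  qed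
  also have "\<Psi> [] \<le> f (0, - y) + m * q"
    using y r f0 q by (auto simp: \<Psi>_def rel_def inbox_def)
  finally show ?thesis by (simp add: q_def)
qed

section \<open>The lazy walk and its rejections\<close>

text \<open>The vertices visited by the lazy walk, most recent first, without repetition for rejections.\<close>

fun hist :: "move list \<Rightarrow> vertex list" where
  "hist [] = [(0, 0)]"
| "hist (a # l) = (if a = Lr \<and> hd (hist l) - (1, 0) \<notin> set (hist l) then hist l
     else (hd (hist l) + dir a) # hist l)"

fun rejections :: "move list \<Rightarrow> nat" where
  "rejections [] = 0"
| "rejections (a # l) = rejections l + of_bool (a = Lr \<and> hd (hist l) - (1, 0) \<notin> set (hist l))"

lemma hist_nonempty [simp]: "hist l \<noteq> []"
  by (induction l) auto

lemma hd_hist: "hd (hist l) = disp l + (int (rejections l), 0)"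
  by (induction l) (auto simp: prod_eq_iff)

lemma length_hist: "length (hist l) + rejections l = length l + 1"
  by (induction l) auto

lemma set_hist: "set (hist l) = {hd (hist l') | l'. suffix l' l}"
proof (induction l)
  case (Cons a l)
  have "{hd (hist l') | l'. suffix l' (a # l)} = insert (hd (hist (a # l))) (set (hist l))"
    unfolding Cons.IH by (auto simp: suffix_Cons simp del: hist.simps)
  then show ?case using hd_in_set[of "hist l"] by auto
qed simp

lemma rejections_mono: "suffix l' l \<Longrightarrow> rejections l' \<le> rejections l"
  by (induction l) (auto simp: suffix_Cons)

lemma rowmax_ge: "strict_suffix l' l \<Longrightarrow> snd (disp l') = y \<Longrightarrow> fst (disp l') \<le> rowmax y l"
proof (induction l)
  case (Cons a l)
  then have "l' = l \<or> strict_suffix l' l" by (auto simp: strict_suffix_def suffix_Cons)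
  then show ?case using Cons by auto
qed simp

text \<open>Earlier vertices of the lazy walk in this row lie at least 2 to the left: their
  \<open>disp\<close> is smaller by 2 or more and their shift is no larger. A gap of 1 would allow
  the left neighbour itself.\<close>

lemma scores_imp_reject:
  assumes "scores (rel y l) a"
  shows "a = Lr" "snd (disp l) = y" "hd (hist l) - (1, 0) \<notin> set (hist l)"
proof -
  have *: "snd (disp l) = y" "fst (disp l) \<ge> rowmax y l + 2" and "a = Lr"
    using assms by (auto simp: scores_def rel_def)
  then show "a = Lr" "snd (disp l) = y" by auto
  show "hd (hist l) - (1, 0) \<notin> set (hist l)"
  proof
    assume "hd (hist l) - (1, 0) \<in> set (hist l)"
    then obtain l' where l': "suffix l' l" "hd (hist l) - (1, 0) = hd (hist l')"
      by (auto simp: set_hist)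
    then have "l' \<noteq> l" by (auto simp: prod_eq_iff)
    with l' have "strict_suffix l' l" by (simp add: strict_suffix_def)
    moreover have "snd (disp l') = y" "fst (disp l') + int (rejections l') = fst (disp l) + int (rejections l) - 1"
      using l'(2) * by (auto simp: hd_hist prod_eq_iff)
    ultimately show False
      using rowmax_ge[of l' l y] rejections_mono[OF l'(1)] * by simp
  qed
qed

text \<open>A move can score only in the row of the current position, so scores in different rows
  are distinct rejections.\<close>

lemma sum_score_le_rejections: "finite Y \<Longrightarrow> (\<Sum>y\<in>Y. score y l) \<le> rejections l"
proof (induction l)
  case (Cons a l)
  have "(\<Sum>y\<in>Y. of_bool (scores (rel y l) a) :: nat) \<le>
      (\<Sum>y\<in>Y. if y = snd (disp l) then of_bool (a = Lr \<and> hd (hist l) - (1, 0) \<notin> set (hist l)) else 0)"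
    by (rule sum_mono) (use scores_imp_reject in auto)
  also have "\<dots> \<le> of_bool (a = Lr \<and> hd (hist l) - (1, 0) \<notin> set (hist l))"
    using Cons.prems by (simp add: sum.delta)
  finally show ?case using Cons by (simp add: sum.distrib)
qed simp

text \<open>With fewer than H m / 2 rejections, more than half of the H rows have fewer than m
  scores; Markov's inequality bounds this whatever the dependence between rows.\<close>

lemma pr_rejections:
  assumes f: "superharmonic r f" and r: "r \<ge> 1" and H: "0 < H" "int H \<le> r"
    and \<epsilon>: "\<And>y. 0 \<le> y \<Longrightarrow> y < int H \<Longrightarrow> f (0, - y) + m * f (-1, 0) + pr t (confined (2 * r)) \<le> \<epsilon>"
  shows "pr t (\<lambda>l. 2 * rejections l < H * m) \<le> 2 * \<epsilon>"
proof -
  let ?Y = "{0..<int H}"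
  have "pr t (\<lambda>l. 2 * rejections l < H * m) \<le> mean t (\<lambda>l. 2 / H * (\<Sum>y\<in>?Y. of_bool (score y l < m)))"
  proof (rule mean_mono)
    fix l
    have nn: "0 \<le> (\<Sum>y\<in>?Y. of_bool (score y l < m) :: real)" by (intro sum_nonneg) auto
    show "of_bool (2 * rejections l < H * m) \<le> 2 / H * (\<Sum>y\<in>?Y. of_bool (score y l < m))"
    proof (cases "2 * rejections l < H * m")
      case True
      have "real m * real H = (\<Sum>y\<in>?Y. real m)" by simp
      also have "\<dots> \<le> (\<Sum>y\<in>?Y. real (score y l) + m * of_bool (score y l < m))"
        by (rule sum_mono) auto
      also have "\<dots> = real (\<Sum>y\<in>?Y. score y l) + m * (\<Sum>y\<in>?Y. of_bool (score y l < m))"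
        by (simp only: sum.distrib sum_distrib_left of_nat_sum)
      also have "real (\<Sum>y\<in>?Y. score y l) \<le> real (rejections l)"
        using sum_score_le_rejections[of ?Y l] by (intro of_nat_mono) simp
      finally have "2 * (real m * real H) \<le> 2 * real (rejections l) + 2 * m * (\<Sum>y\<in>?Y. of_bool (score y l < m))"
        by simp
      also have "2 * real (rejections l) < real H * real m"
        using True by (metis of_nat_less_iff of_nat_mult of_nat_numeral)
      finally have "real m * real H < real m * (2 * (\<Sum>y\<in>?Y. of_bool (score y l < m)))"
        by (simp add: algebra_simps)
      then have "real H < 2 * (\<Sum>y\<in>?Y. of_bool (score y l < m))"
        by (simp add: mult_less_cancel_left)
      then show ?thesis using True H by (simp add: field_simps)
    next
      case False
      then show ?thesis using nn by simp
    qed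
  qed
  also have "\<dots> = 2 / H * (\<Sum>y\<in>?Y. pr t (\<lambda>l. score y l < m))"
    by (simp only: mean_cmult mean_sum)
  also have "\<dots> \<le> 2 / H * (\<Sum>y\<in>?Y. \<epsilon>)"
  proof (intro mult_left_mono sum_mono)
    fix y assume y: "y \<in> ?Y"
    then have "pr t (\<lambda>l. score y l < m) \<le> f (0, - y) + m * f (-1, 0) + pr t (confined (2 * r))"
      using H by (intro pr_score[OF f r]) auto
    also have "\<dots> \<le> \<epsilon>" using \<epsilon> y by auto
    finally show "pr t (\<lambda>l. score y l < m) \<le> \<epsilon>" .
  qed simp
  also have "\<dots> = 2 * \<epsilon>" using H by simp
  finally show ?thesis .
qed

section \<open>Choice of scales\<close>

lemma suffix_of_drop:
  assumes "suffix l' l" "length l = T"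
  shows "t \<le> length l' \<Longrightarrow> suffix (drop (T - t) l) l'" "length l' \<le> t \<Longrightarrow> suffix l' (drop (T - t) l)"
proof -
  have *: "suffix (drop (T - t) l) l" by (rule suffix_drop)
  show "suffix (drop (T - t) l) l'" if "t \<le> length l'"
    using suffix_length_suffix[OF * assms(1)] that assms by (simp add: suffix_length_le)
  show "suffix l' (drop (T - t) l)" if "length l' \<le> t"
    using suffix_length_suffix[OF assms(1) *] that assms suffix_length_le[OF assms(1)] by simp
qed

lemma exists_decay: "\<exists>p\<ge>1. (1 - \<gamma>) ^ p \<le> 1 / 160"
proof -
  obtain n where n: "(1 - \<gamma>) ^ n < 1 / 160"
    using real_arch_pow_inv[of "1/160" "1 - \<gamma>"] by (auto simp: \<gamma>_def)
  then have "n \<noteq> 0" by (intro notI) simp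
  with n show ?thesis by (intro exI[of _ n]) auto
qed

locale scales =
  fixes p :: nat
  assumes p_pos: "p \<ge> 1" and p: "(1 - \<gamma>) ^ p \<le> 1 / 160"
begin

text \<open>Survival from (-1, 0) to radius 160^(N s) has probability at most 160^(-(p + 4) s), so a
  row can be asked for 160^((p + 3) s) scores at an error of 160^(-s).\<close>

definition N :: nat where "N = p * (p + 4)"

text \<open>The square root of \<open>time s\<close> exceeds the box radius 160^(N s) by the factor
  160^s, which makes confinement unlikely.\<close>

definition time :: "nat \<Rightarrow> nat" where "time s = 160 ^ (2 * (N * s) + 2 * s)"

lemma decay: "(1 - \<gamma>) ^ (p * k) \<le> (1 / 160) ^ k"
  unfolding power_mult using p by (intro power_mono) (auto simp: \<gamma>_def)

lemma pr_few_rejections: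
  "pr (time s) (\<lambda>l. 2 * rejections l < 160 ^ (N * s + 3 * s)) \<le> 40 * (1 / 160) ^ s"
proof -
  define J where "J = N * s"
  have J: "J = p * ((p + 4) * s)" by (simp add: J_def N_def)
  have ps: "p * s \<le> J" unfolding J by simp
  obtain f where f: "superharmonic (160 ^ J) f"
    and fi: "\<And>i z. i \<le> J \<Longrightarrow> inbox (160 ^ i) z \<Longrightarrow> f z \<le> (1 - \<gamma>) ^ (J - i)"
    using exists_superharmonic[of J] by blast
  define m :: nat where "m = 160 ^ ((p + 3) * s)"
  \<comment> \<open>These rows are p s scales closer to the start than the box radius: leaving the
    box before the first score in such a row has probability at most 160^(-s).\<close>
  define H :: nat where "H = 160 ^ (J - p * s)"
  have "J - p * s + (p + 3) * s = J + 3 * s"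
    using ps by (simp add: algebra_simps)
  then have Hm: "H * m = 160 ^ (J + 3 * s)"
    unfolding H_def m_def power_add[symmetric] by simp
  \<comment> \<open>Three errors per row, namely 1, 1 and 18 times 160^(-s): escape before the first
    score, escape between scores, and confinement.\<close>
  have "pr (time s) (\<lambda>l. 2 * rejections l < H * m) \<le> 2 * (20 * (1 / 160) ^ s)"
  proof (rule pr_rejections[OF f])
    show "(1::int) \<le> 160 ^ J" by simp
    show "0 < H" by (simp add: H_def)
    show "int H \<le> 160 ^ J" by (simp add: H_def)
    fix y :: int assume y: "0 \<le> y" "y < int H"
    have "f (0, - y) \<le> (1 - \<gamma>) ^ (J - (J - p * s))"
      using y by (intro fi) (auto simp: inbox_def H_def)
    also have "\<dots> \<le> (1 / 160) ^ s" using ps decay[of s] by simp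
    finally have 1: "f (0, - y) \<le> (1 / 160) ^ s" .
    have "f (-1, 0) \<le> (1 - \<gamma>) ^ (J - 0)"
      by (intro fi) (auto simp: inbox_def)
    also have "\<dots> \<le> (1 / 160) ^ ((p + 4) * s)" unfolding J using decay by simp
    finally have "m * f (-1, 0) \<le> m * (1 / 160) ^ ((p + 4) * s)"
      by (intro mult_left_mono) auto
    also have "\<dots> = (160 * (1 / 160)) ^ ((p + 3) * s) * (1 / 160) ^ s"
    proof -
      have e: "(p + 4) * s = (p + 3) * s + s" by (simp add: algebra_simps)
      show ?thesis unfolding e m_def power_add power_mult_distrib of_nat_power by simp
    qed
    finally have 2: "m * f (-1, 0) \<le> (1 / 160) ^ s" by simp
    have "real (time s) * pr (time s) (confined (2 * 160 ^ J)) \<le> 2 * (2 * 160 ^ J + 1)\<^sup>2"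
      using pr_confined[of "2 * 160 ^ J" "time s"] by simp
    also have "\<dots> \<le> 2 * (3 * 160 ^ J)\<^sup>2"
      by (intro mult_left_mono power_mono) auto
    also have "\<dots> = 18 * (160 ^ (2 * J) * (160 * (1 / 160)) ^ (2 * s))"
      by (simp add: power_mult_distrib power_mult mult.commute[of 2 J])
    also have "\<dots> = real (time s) * (18 * (1 / 160) ^ (2 * s))"
      unfolding time_def J_def power_mult_distrib power_add of_nat_power of_nat_mult by simp
    finally have "pr (time s) (confined (2 * 160 ^ J)) \<le> 18 * (1 / 160) ^ (2 * s)"
      by (rule mult_left_le_imp_le) (simp add: time_def)
    also have "\<dots> \<le> 18 * (1 / 160) ^ s"
      by (intro mult_left_mono power_decreasing) auto
    finally show "f (0, - y) + m * f (-1, 0) + pr (time s) (confined (2 * 160 ^ J)) \<le> 20 * (1 / 160) ^ s"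
      using 1 2 by simp
  qed
  then show ?thesis by (simp add: Hm J_def)
qed

section \<open>Horizontal position along geometric blocks of time\<close>

definition bad :: "nat \<Rightarrow> move list \<Rightarrow> bool" where
  "bad s l \<longleftrightarrow> (\<exists>l'. suffix l' l \<and> time s \<le> length l' \<and> length l' \<le> time (Suc s) \<and>
     4 * real_of_int (fst (hd (hist l'))) \<le> 160 ^ (N * s + 3 * s))"

text \<open>Outside two unlikely events, at least 160^(N s + 3 s) / 2 rejections are present when
  the block starts and persist through it, while the maximal inequality up to the end of the block
  keeps |\<open>fst (disp l')\<close>| below half of that.\<close>

lemma pr_bad: "pr T (bad s) \<le> (40 + 8 * 160 ^ (2 * N + 2)) * (1 / 160) ^ s"
proof (cases "T < time s")
  case True
  have "pr T (bad s) \<le> pr T (\<lambda>_. False)"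
    using True by (intro pr_mono) (auto simp: bad_def dest!: suffix_length_le)
  also have "\<dots> \<le> (40 + 8 * 160 ^ (2 * N + 2)) * (1 / 160) ^ s" by simp
  finally show ?thesis .
next
  case False
  \<comment> \<open>The word may end inside the block.\<close>
  define u where "u = min T (time (Suc s))"
  define c :: real where "c = 160 ^ (N * s + 3 * s) / 4"
  have "pr T (bad s) \<le> pr T (\<lambda>l. 2 * rejections (drop (T - time s) l) < 160 ^ (N * s + 3 * s)
      \<or> escaped c (drop (T - u) l))"
  proof (rule pr_mono, rule ccontr)
    fix l assume len: "length l = T" and "bad s l"
      and neg: "\<not> (2 * rejections (drop (T - time s) l) < 160 ^ (N * s + 3 * s) \<or> escaped c (drop (T - u) l))"
    then obtain l' where l': "suffix l' l" "time s \<le> length l'" "length l' \<le> time (Suc s)"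
      "4 * real_of_int (fst (hd (hist l'))) \<le> 160 ^ (N * s + 3 * s)" by (auto simp: bad_def)
    have "rejections (drop (T - time s) l) \<le> rejections l'"
      using l' len by (intro rejections_mono suffix_of_drop) auto
    then have "160 ^ (N * s + 3 * s) \<le> 2 * rejections l'" using neg by linarith
    then have "real (160 ^ (N * s + 3 * s)) \<le> real (2 * rejections l')" by (rule of_nat_mono)
    then have R: "2 * c \<le> real (rejections l')" by (simp add: c_def)
    have "suffix l' (drop (T - u) l)"
      using l' len suffix_length_le[OF l'(1)] by (intro suffix_of_drop) (auto simp: u_def)
    then have "\<bar>real_of_int (fst (disp l'))\<bar> < c" using neg by (auto simp: escaped_iff not_le)
    then show False using l'(4) R by (simp add: hd_hist c_def)
  qed
  also have "\<dots> \<le> pr T (\<lambda>l. 2 * rejections (drop (T - time s) l) < 160 ^ (N * s + 3 * s))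
      + pr T (\<lambda>l. escaped c (drop (T - u) l))"
    by (rule pr_disj)
  also have "pr T (\<lambda>l. 2 * rejections (drop (T - time s) l) < 160 ^ (N * s + 3 * s))
      = pr (time s) (\<lambda>l. 2 * rejections l < 160 ^ (N * s + 3 * s))"
    using mean_drop[of "time s" "T - time s" "\<lambda>l. of_bool (2 * rejections l < 160 ^ (N * s + 3 * s))"] False
    by simp
  also have "\<dots> \<le> 40 * (1 / 160) ^ s" by (rule pr_few_rejections)
  also have "pr T (\<lambda>l. escaped c (drop (T - u) l)) = pr u (escaped c)"
    using mean_drop[of u "T - u" "\<lambda>l. of_bool (escaped c l)"] by (simp add: u_def)
  also have "\<dots> \<le> real u / (2 * c\<^sup>2)" by (rule pr_escaped) (simp add: c_def)
  also have "\<dots> \<le> real (time (Suc s)) / (2 * c\<^sup>2)"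
    by (intro divide_right_mono) (auto simp: u_def)
  also have "\<dots> = 8 * 160 ^ (2 * N + 2) * (1 / 160) ^ (4 * s)"
  proof -
    have e: "2 * (N * Suc s) + 2 * Suc s + 4 * s = (2 * N + 2) + 2 * (N * s + 3 * s)" by simp
    have "real (time (Suc s)) * 160 ^ (4 * s) = 160 ^ (2 * N + 2) * (160 ^ (N * s + 3 * s))\<^sup>2"
      unfolding time_def of_nat_power power_mult[symmetric] mult.commute[of _ 2] power_add[symmetric]
      by (simp only: of_nat_numeral power_add[symmetric] e)
    then have *: "real (time (Suc s)) = 160 ^ (2 * N + 2) * (160 ^ (N * s + 3 * s))\<^sup>2 * (1 / 160) ^ (4 * s)"
      by (simp add: power_one_over eq_divide_eq)
    show ?thesis unfolding * c_def by (simp add: power_divide)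
  qed
  also have "\<dots> \<le> 8 * 160 ^ (2 * N + 2) * (1 / 160) ^ s"
    by (intro mult_left_mono power_decreasing) auto
  finally show ?thesis by (simp add: algebra_simps)
qed

lemma le_time: "s \<le> time s"
proof -
  have "s < 160 ^ s" by (rule power_gt_expt) simp
  also have "\<dots> \<le> time s" unfolding time_def by (intro power_increasing) auto
  finally show ?thesis by simp
qed

text \<open>The bound is uniform in the horizon T because T tends to infinity later. The sum over
  blocks is geometric, and s0 > |fst v| puts v below the threshold of every block from s0
  on.\<close>

lemma pr_late_visit:
  assumes s0: "\<bar>fst v\<bar> < int s0"
  shows "pr T (\<lambda>l. \<exists>l'. suffix l' l \<and> time s0 \<le> length l' \<and> hd (hist l') = v)
    \<le> (40 + 8 * 160 ^ (2 * N + 2)) * (2 * (1 / 160) ^ s0)"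
proof -
  let ?C = "40 + 8 * 160 ^ (2 * N + 2) :: real"
  have "pr T (\<lambda>l. \<exists>l'. suffix l' l \<and> time s0 \<le> length l' \<and> hd (hist l') = v)
    \<le> pr T (\<lambda>l. \<exists>s\<in>{s0..T}. bad s l)"
  proof (rule pr_mono)
    fix l assume len: "length l = T" and "\<exists>l'. suffix l' l \<and> time s0 \<le> length l' \<and> hd (hist l') = v"
    then obtain l' where l': "suffix l' l" "time s0 \<le> length l'" "hd (hist l') = v" by blast
    define s where "s = (GREATEST s. time s \<le> length l')"
    have bnd: "\<forall>s. time s \<le> length l' \<longrightarrow> s \<le> length l'" using le_time order_trans by blast
    have s: "time s \<le> length l'"
      unfolding s_def by (rule GreatestI_nat[of _ s0]) (use l' bnd in auto)
    have ss0: "s0 \<le> s"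
      unfolding s_def by (rule Greatest_le_nat) (use l' bnd in auto)
    have "\<not> time (Suc s) \<le> length l'"
    proof
      assume "time (Suc s) \<le> length l'"
      then have "Suc s \<le> (GREATEST s. time s \<le> length l')"
        using bnd by (intro Greatest_le_nat) auto
      then show False by (simp add: s_def[symmetric])
    qed
    moreover have "4 * real_of_int (fst v) \<le> 160 ^ (N * s + 3 * s)"
    proof -
      have "real s < real (160 ^ s)"
        by (intro of_nat_less_iff[THEN iffD2] power_gt_expt) simp
      then have "real s \<le> 160 ^ s" by simp
      have "4 * \<bar>real_of_int (fst v)\<bar> \<le> 160 * real s"
        using s0 ss0 by linarith
      also have "\<dots> \<le> 160 ^ Suc s" using \<open>real s \<le> 160 ^ s\<close> by simp
      also have "\<dots> \<le> 160 ^ (N * s + 3 * s)"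
        using s0 ss0 by (intro power_increasing) auto
      finally show ?thesis by linarith
    qed
    ultimately have "bad s l" using l' s by (auto simp: bad_def intro!: exI[of _ l'])
    moreover have "s \<le> T" using le_time[of s] s suffix_length_le[OF l'(1)] len by linarith
    ultimately show "\<exists>s\<in>{s0..T}. bad s l" using ss0 by auto
  qed
  also have "\<dots> \<le> (\<Sum>s\<in>{s0..T}. pr T (bad s))" by (rule pr_bex) simp
  also have "\<dots> \<le> (\<Sum>s\<in>{s0..T}. ?C * (1 / 160) ^ s)" by (intro sum_mono pr_bad)
  also have "\<dots> = ?C * (\<Sum>s\<in>{s0..T}. (1 / 160) ^ s)" by (simp only: sum_distrib_left)
  also have "\<dots> \<le> ?C * (2 * (1 / 160) ^ s0)"
  proof (rule mult_left_mono)
    show "(\<Sum>s\<in>{s0..T}. (1 / 160) ^ s) \<le> 2 * (1 / 160 :: real) ^ s0"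
    proof (cases "T < s0")
      case False
      have "(\<Sum>s\<in>{s0..T}. (1 / 160) ^ s) = ((1 / 160) ^ s0 - (1 / 160) ^ Suc T) / (159 / 160 :: real)"
        using False unfolding sum_gp by simp
      also have "\<dots> \<le> (1 / 160) ^ s0 / (159 / 160)"
        by (intro divide_right_mono) auto
      also have "\<dots> = (160 / 159) * (1 / 160) ^ s0" by simp
      also have "\<dots> \<le> 2 * (1 / 160) ^ s0" by (intro mult_right_mono) auto
      finally show ?thesis .
    qed simp
  qed simp
  finally show ?thesis .
qed

end

lemma late_visits_unlikely:
  assumes "\<epsilon> > 0"
  shows "\<exists>n. \<forall>T. pr T (\<lambda>l. \<exists>l'. suffix l' l \<and> n \<le> length l' \<and> hd (hist l') = v) \<le> \<epsilon>"
proof -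
  obtain p where "p \<ge> 1" "(1 - \<gamma>) ^ p \<le> 1 / 160" using exists_decay by blast
  then interpret scales p by unfold_locales
  have "(\<lambda>s. (40 + 8 * 160 ^ (2 * N + 2)) * (2 * (1 / 160) ^ s) :: real) \<longlonglongrightarrow>
      (40 + 8 * 160 ^ (2 * N + 2)) * (2 * 0)"
    by (intro tendsto_mult tendsto_const LIMSEQ_power_zero) simp
  then have "eventually (\<lambda>s. (40 + 8 * 160 ^ (2 * N + 2)) * (2 * (1 / 160) ^ s) < \<epsilon>) sequentially"
    using assms by (intro order_tendstoD(2)) auto
  moreover have "eventually (\<lambda>s. nat \<bar>fst v\<bar> < s) sequentially" by (rule eventually_gt_at_top)
  ultimately have "eventually (\<lambda>s. (40 + 8 * 160 ^ (2 * N + 2)) * (2 * (1 / 160) ^ s) < \<epsilon> \<and> nat \<bar>fst v\<bar> < s) sequentially"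
    by (rule eventually_conj)
  then obtain s where s: "(40 + 8 * 160 ^ (2 * N + 2)) * (2 * (1 / 160) ^ s) < \<epsilon>" "nat \<bar>fst v\<bar> < s"
    by (auto simp: eventually_sequentially)
  then have "\<bar>fst v\<bar> < int s" by linarith
  from pr_late_visit[OF this] s(1) show ?thesis
    by (intro exI[of _ "time s"]) (meson less_imp_le order_trans)
qed

section \<open>The law of the jump chain\<close>

definition stay :: "vertex list \<Rightarrow> real" where
  "stay xs = of_bool (hd xs - (1, 0) \<notin> set xs) / 8"

definition jump :: "vertex list \<Rightarrow> vertex \<Rightarrow> real" where
  "jump xs v =
    (if v - hd xs \<in> {(1, 0), (0, 1), (0, -1)} then 1 / 4
     else if v - hd xs = (-1, 0) then 1 / 4 - stay xs else 0)"

text \<open>Path probability of the MAW, latest vertex first: dividing by \<open>1 - stay xs\<close>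
  conditions the lazy step on not being rejected.\<close>

fun law :: "vertex list \<Rightarrow> real" where
  "law [] = 0"
| "law [v] = of_bool (v = (0, 0))"
| "law (v # xs) = law xs * (jump xs v / (1 - stay xs))"

lemma stay_bounds: "0 \<le> stay xs" "stay xs \<le> 1 / 8"
  by (auto simp: stay_def)

text \<open>\<open>suffix (v # xs) (hist l)\<close> says that the jump chain started along this
  path. Further moves preserve it, so its probability grows exactly by the jumps to v made from the
  history \<open>xs\<close>.\<close>

lemma pr_extends_Suc:
  assumes "xs \<noteq> []"
  shows "pr (Suc t) (\<lambda>l. suffix (v # xs) (hist l)) =
    pr t (\<lambda>l. suffix (v # xs) (hist l)) + jump xs v * pr t (\<lambda>l. hist l = xs)"
proof -
  have "avg (\<lambda>a. of_bool (suffix (v # xs) (hist (a # l)))) =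
     of_bool (suffix (v # xs) (hist l)) + jump xs v * of_bool (hist l = xs)" for l
  proof -
    define h where "h = hist l"
    have sfx: "suffix (v # xs) (w # h) \<longleftrightarrow> (w = v \<and> h = xs) \<or> suffix (v # xs) h" for w
      by (auto simp: suffix_Cons)
    show ?thesis
    proof (cases "h = xs")
      case True
      have [simp]: "\<not> suffix (v # xs) xs" using suffix_length_le by fastforce
      define d where "d = v - hd xs"
      have v: "hd xs + w = v \<longleftrightarrow> w = d" for w by (auto simp: d_def algebra_simps)
      define b where "b \<longleftrightarrow> hd xs - (1, 0) \<in> set xs"
      have "of_bool (suffix (v # xs) (hist (a # l))) = (of_bool (dir a = d \<and> (a = Lr \<longrightarrow> b)) :: real)" for a
        by (simp add: h_def[symmetric] True sfx[unfolded True] v b_def)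
      then have "avg (\<lambda>a. of_bool (suffix (v # xs) (hist (a # l)))) = jump xs v"
        by (simp add: avg_def jump_def stay_def d_def[symmetric] b_def[symmetric])
      then show ?thesis by (simp add: h_def[symmetric] True)
    next
      case False
      then show ?thesis by (simp add: avg_def h_def[symmetric] sfx)
    qed
  qed
  then show ?thesis by (simp add: mean_add mean_cmult)
qed

text \<open>Balance at the history \<open>xs\<close>: the lazy walk stayed there or has just
  arrived, and arrivals are the increase of the permanent event
  \<open>suffix xs (hist l)\<close>.\<close>

lemma pr_hist_Suc:
  assumes "xs \<noteq> []"
  shows "pr (Suc t) (\<lambda>l. hist l = xs) = stay xs * pr t (\<lambda>l. hist l = xs) +
    (pr (Suc t) (\<lambda>l. suffix xs (hist l)) - pr t (\<lambda>l. suffix xs (hist l)))"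
proof -
  have "avg (\<lambda>a. of_bool (hist (a # l) = xs)) + of_bool (suffix xs (hist l)) =
    stay xs * of_bool (hist l = xs) + avg (\<lambda>a. of_bool (suffix xs (hist (a # l))))" for l
  proof -
    define h where "h = hist l"
    have sfx: "suffix xs (w # h) \<longleftrightarrow> w # h = xs \<or> suffix xs h" for w
      by (auto simp: suffix_Cons)
    have [simp]: "suffix xs (w # xs)" for w
      by (simp add: suffix_Cons)
    have "w # h \<noteq> xs" if "suffix xs h" for w
      using suffix_length_le[OF that] by auto
    then show ?thesis
      by (cases "h = xs"; cases "suffix xs h")
        (auto simp: avg_def h_def[symmetric] sfx stay_def)
  qed
  then have "mean t (\<lambda>l. avg (\<lambda>a. of_bool (hist (a # l) = xs)) + of_bool (suffix xs (hist l))) =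
    mean t (\<lambda>l. stay xs * of_bool (hist l = xs) + avg (\<lambda>a. of_bool (suffix xs (hist (a # l)))))"
    by simp
  then show ?thesis by (simp add: mean_add mean_cmult)
qed

text \<open>Expected number of times before T at which the history is \<open>xs\<close>, a truncated
  Green function.\<close>

definition occupation :: "vertex list \<Rightarrow> nat \<Rightarrow> real" where
  "occupation xs T = (\<Sum>t<T. pr t (\<lambda>l. hist l = xs))"

lemma occupation_Suc:
  assumes "xs \<noteq> []"
  shows "occupation xs (Suc T) = stay xs * occupation xs T + pr T (\<lambda>l. suffix xs (hist l))"
proof (induction T)
  case 0
  have "(suffix xs [(0, 0)]) = ([(0, 0)] = xs)" using assms by (auto simp: suffix_Cons)
  then show ?case by (simp add: occupation_def)
next
  case (Suc T)
  have "occupation xs (Suc (Suc T)) = occupation xs (Suc T) + pr (Suc T) (\<lambda>l. hist l = xs)"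
    by (simp add: occupation_def)
  also have "\<dots> = stay xs * occupation xs (Suc T) + pr (Suc T) (\<lambda>l. suffix xs (hist l))"
  proof -
    have "occupation xs (Suc T) = occupation xs T + pr T (\<lambda>l. hist l = xs)"
      by (simp add: occupation_def)
    then have "stay xs * occupation xs (Suc T) = stay xs * occupation xs T + stay xs * pr T (\<lambda>l. hist l = xs)"
      by (simp add: algebra_simps)
    then show ?thesis using pr_hist_Suc[OF assms, of T] Suc.IH by linarith
  qed
  finally show ?case .
qed

lemma pr_extends_occupation:
  assumes "xs \<noteq> []"
  shows "pr T (\<lambda>l. suffix (v # xs) (hist l)) = jump xs v * occupation xs T"
proof (induction T)
  case 0
  then show ?case using assms by (auto simp: occupation_def suffix_Cons)
next
  case (Suc T)
  then show ?case unfolding pr_extends_Suc[OF assms] by (simp add: occupation_def algebra_simps)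
qed

lemma last_hist: "last (hist l) = (0, 0)"
  by (induction l) auto

lemma suffix_singleton_iff: "ys \<noteq> [] \<Longrightarrow> suffix [v] ys \<longleftrightarrow> last ys = v"
  by (induction ys) (auto simp: suffix_Cons)

text \<open>The occupation is increasing and bounded, and its limit solves L = stay L + law: the
  geometric holding time contributes 1 / (1 - stay), the normalisation in
  \<open>law\<close>.\<close>

lemma pr_extends_tendsto_law:
  "xs \<noteq> [] \<Longrightarrow> (\<lambda>T. pr T (\<lambda>l. suffix xs (hist l))) \<longlonglongrightarrow> law xs"
proof (induction xs rule: law.induct)
  case (2 v)
  have "(\<lambda>T. pr T (\<lambda>l. suffix [v] (hist l))) = (\<lambda>T. law [v])"
    by (auto simp: suffix_singleton_iff last_hist)
  then show ?case by simp
next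
  case (3 v x xs)
  let ?xs = "x # xs"
  have occ_nonneg: "0 \<le> occupation ?xs T" for T
    unfolding occupation_def by (intro sum_nonneg mean_nonneg) auto
  have "incseq (occupation ?xs)"
    by (rule incseq_SucI) (auto simp: occupation_def intro!: mean_nonneg)
  \<comment> \<open>As stay <= 1/8, the bound 2 reproduces itself: 2/8 + 1 <= 2.\<close>
  moreover have "occupation ?xs T \<le> 2" for T
  proof (induction T)
    case (Suc T)
    have "stay ?xs * occupation ?xs T \<le> 1 / 8 * 2"
      using Suc stay_bounds[of ?xs] occ_nonneg by (intro mult_mono) auto
    then show ?case
      using pr_le_1[of T "\<lambda>l. suffix ?xs (hist l)"] occupation_Suc[of ?xs T] by simp
  qed (simp add: occupation_def)
  ultimately obtain L where L: "occupation ?xs \<longlonglongrightarrow> L"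
    using incseq_convergent[of "occupation ?xs" 2] by metis
  have "(\<lambda>T. stay ?xs * occupation ?xs T + pr T (\<lambda>l. suffix ?xs (hist l))) \<longlonglongrightarrow> stay ?xs * L + law ?xs"
    by (intro tendsto_intros L 3) simp
  moreover have "(\<lambda>T. stay ?xs * occupation ?xs T + pr T (\<lambda>l. suffix ?xs (hist l))) \<longlonglongrightarrow> L"
    using LIMSEQ_Suc[OF L] by (simp add: occupation_Suc)
  ultimately have "L = stay ?xs * L + law ?xs" by (rule LIMSEQ_unique[rotated])
  then have "L = law ?xs / (1 - stay ?xs)"
    using stay_bounds[of ?xs] by (simp add: field_simps)
  then show ?case
    using tendsto_mult[OF tendsto_const[of "jump ?xs v"] L]
    by (simp add: pr_extends_occupation mult.commute)
qed simp

text \<open>The history grows by at most one vertex per move, so each nonempty initial part of the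
  path was the complete history at some time.\<close>

lemma suffix_hist_imp:
  "suffix ys (hist l) \<Longrightarrow> ys \<noteq> [] \<Longrightarrow> \<exists>l'. suffix l' l \<and> hist l' = ys"
proof (induction l)
  case Nil
  then show ?case by (auto simp: suffix_Cons)
next
  case (Cons a l)
  then show ?case
    by (cases "ys = hist (a # l)")
      (auto simp: suffix_Cons split: if_splits)
qed

lemma length_hist_le: "length (hist l) \<le> Suc (length l)"
  using length_hist[of l] by linarith

text \<open>Distinct paths of equal length are disjoint events, and the jump chain is never ahead of
  the lazy clock: a visit at jump time m - i >= n is a visit of the lazy walk at time n or later. As
  \<open>F\<close> is finite, the bound survives the limit in T.\<close>

lemma sum_law_late_visit_le:
  assumes \<epsilon>: "\<And>T. pr T (\<lambda>l. \<exists>l'. suffix l' l \<and> n \<le> length l' \<and> hd (hist l') = v) \<le> \<epsilon>"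
    and F: "finite F" "\<And>xs. xs \<in> F \<Longrightarrow> length xs = Suc m \<and> (\<exists>i. i + n \<le> m \<and> xs ! i = v)"
  shows "(\<Sum>xs\<in>F. law xs) \<le> \<epsilon>"
proof (rule LIMSEQ_le_const2)
  have F_len: "length xs = Suc m" if "xs \<in> F" for xs using F(2)[OF that] ..
  show "(\<lambda>T. \<Sum>xs\<in>F. pr T (\<lambda>l. suffix xs (hist l))) \<longlonglongrightarrow> (\<Sum>xs\<in>F. law xs)"
    using F(2) by (intro tendsto_sum pr_extends_tendsto_law) fastforce
  have "(\<Sum>xs\<in>F. pr T (\<lambda>l. suffix xs (hist l))) \<le> \<epsilon>" for T
  proof -
    have "(\<Sum>xs\<in>F. pr T (\<lambda>l. suffix xs (hist l))) \<le>
      pr T (\<lambda>l. \<exists>l'. suffix l' l \<and> n \<le> length l' \<and> hd (hist l') = v)" (is "_ \<le> pr T ?Q")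
      unfolding mean_sum[symmetric]
    proof (rule mean_mono)
      fix l
      show "(\<Sum>xs\<in>F. of_bool (suffix xs (hist l))) \<le> (of_bool (?Q l) :: real)"
      proof (cases "\<exists>xs\<in>F. suffix xs (hist l)")
        case True
        then obtain xs where xs: "xs \<in> F" "suffix xs (hist l)" by blast
        have "ys = xs" if "ys \<in> F" "suffix ys (hist l)" for ys
        proof -
          have len: "length ys = length xs" by (simp only: F_len that(1) xs(1))
          then have "suffix ys xs" by (intro suffix_length_suffix[OF that(2) xs(2)]) simp
          then show ?thesis using len by (auto simp: suffix_def)
        qed
        then have "suffix ys (hist l) \<longleftrightarrow> ys = xs" if "ys \<in> F" for ys
          using xs(2) that by blast
        then have "(\<Sum>ys\<in>F. of_bool (suffix ys (hist l))) = (\<Sum>ys\<in>F. if ys = xs then 1 else 0 :: real)"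
          by (intro sum.cong refl) simp
        also have "\<dots> = 1" using xs(1) F(1) by simp
        finally have sum1: "(\<Sum>ys\<in>F. of_bool (suffix ys (hist l))) = (1 :: real)" .
        obtain i where i: "i + n \<le> m" "xs ! i = v" and len: "length xs = Suc m"
          using F(2)[OF xs(1)] by blast
        have "suffix (drop i xs) (hist l)"
          using xs(2) suffix_drop[of i xs] by (rule suffix_order.trans[rotated])
        moreover have "drop i xs \<noteq> []" using i len by simp
        ultimately obtain l' where l': "suffix l' l" "hist l' = drop i xs"
          using suffix_hist_imp by blast
        have "hd (hist l') = v" using l' i len by (simp add: hd_drop_conv_nth)
        moreover have "n \<le> length l'" using length_hist_le[of l'] l'(2) len i by simp
        ultimately have "?Q l" using l' by blast
        then show ?thesis using sum1 by simp
      next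
        case False
        then have "(\<Sum>ys\<in>F. of_bool (suffix ys (hist l))) = (0 :: real)"
          by (intro sum.neutral) auto
        then show ?thesis by simp
      qed
    qed
    then show ?thesis using \<epsilon>[of T] by linarith
  qed
  then show "\<exists>N. \<forall>T\<ge>N. (\<Sum>xs\<in>F. pr T (\<lambda>l. suffix xs (hist l))) \<le> \<epsilon>" by blast
qed

section \<open>One-step probabilities of the MAW\<close>

lemma incident_edges:
  "{e \<in> lattice_edges. p \<in> e} = {{p, p + (1, 0)}, {p, p - (1, 0)}, {p, p + (0, 1)}, {p, p - (0, 1)}}"
proof (intro equalityI subsetI)
  fix e assume "e \<in> {e \<in> lattice_edges. p \<in> e}"
  then consider q where "e = {q, q + (0, 1)}" "p \<in> e" | q where "e = {q, q + (1, 0)}" "p \<in> e"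
    by (auto simp: lattice_edges_def vertical_edges_def horizontal_edges_def)
  then show "e \<in> {{p, p + (1, 0)}, {p, p - (1, 0)}, {p, p + (0, 1)}, {p, p - (0, 1)}}"
    by cases auto
next
  have "{p, p + (0, 1)} \<in> vertical_edges" "{p, p + (1, 0)} \<in> horizontal_edges" for p
    unfolding vertical_edges_def horizontal_edges_def by blast+
  from this[of p] this[of "p - (0, 1)"] this[of "p - (1, 0)"]
  have "{p, p + (0, 1)} \<in> lattice_edges" "{p, p + (1, 0)} \<in> lattice_edges"
    "{p, p - (0, 1)} \<in> lattice_edges" "{p, p - (1, 0)} \<in> lattice_edges"
    by (auto simp: lattice_edges_def insert_commute)
  then show "e \<in> {e \<in> lattice_edges. p \<in> e}"
    if "e \<in> {{p, p + (1, 0)}, {p, p - (1, 0)}, {p, p + (0, 1)}, {p, p - (0, 1)}}" for e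
    using that by auto
qed

text \<open>A horizontal edge is reinforced only from its left endpoint, so the edge to the left has
  conductance 2 exactly if the left neighbour was visited. Conductances are 8 times the lazy
  weights. The index \<open>t - s\<close> undoes the reversed order of \<open>xs\<close>.\<close>

lemma step_prob_eq:
  assumes "length xs = Suc t"
  shows "step_prob (\<lambda>s. xs ! (t - s)) t v = jump xs v / (1 - stay xs)"
proof -
  define x where "x s = xs ! (t - s)" for s
  define p where "p = hd xs"
  have xt: "x t = p" using assms by (cases xs) (auto simp: x_def p_def)
  have visited: "(\<exists>s\<le>t. x s = q) \<longleftrightarrow> q \<in> set xs" for q
  proof
    assume "q \<in> set xs"
    then obtain i where "i < Suc t" "xs ! i = q" by (auto simp: in_set_conv_nth assms)
    then show "\<exists>s\<le>t. x s = q" by (intro exI[of _ "t - i"]) (auto simp: x_def)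
  qed (use assms in \<open>auto simp: x_def\<close>)
  have vert: "conductance x t {p, p + (0, 1)} = 2" "conductance x t {p, p - (0, 1)} = 2"
  proof -
    have "{p - (0, 1), p - (0, 1) + (0, 1)} \<in> vertical_edges" "{p, p + (0, 1)} \<in> vertical_edges"
      unfolding vertical_edges_def by blast+
    then show "conductance x t {p, p + (0, 1)} = 2" "conductance x t {p, p - (0, 1)} = 2"
      by (auto simp: conductance_def insert_commute)
  qed
  have right: "conductance x t {p, p + (1, 0)} = 2"
    using xt by (auto simp: conductance_def)
  have "{p, p - (1, 0)} \<notin> vertical_edges"
    by (auto simp: vertical_edges_def doubleton_eq_iff prod_eq_iff)
  moreover have "{p, p - (1, 0)} = {q, q + (1, 0)} \<longleftrightarrow> q = p - (1, 0)" for q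
    by (auto simp: doubleton_eq_iff prod_eq_iff)
  ultimately have left: "conductance x t {p, p - (1, 0)} = 2 - 8 * stay xs"
    using visited[of "p - (1, 0)"] by (auto simp: conductance_def stay_def p_def)
  have "(\<Sum>e\<in>{e \<in> lattice_edges. x t \<in> e}. conductance x t e) = 8 - 8 * stay xs"
    unfolding xt incident_edges
    by (simp add: doubleton_eq_iff prod_eq_iff vert right left)
  moreover have "{p, v} \<in> lattice_edges \<longleftrightarrow> v - p \<in> {(1, 0), (-1, 0), (0, 1), (0, -1)}"
  proof -
    have "{p, v} \<in> lattice_edges \<longleftrightarrow> {p, v} \<in> {e \<in> lattice_edges. p \<in> e}" by simp
    also have "\<dots> \<longleftrightarrow> v - p \<in> {(1, 0), (-1, 0), (0, 1), (0, -1)}"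
      unfolding incident_edges by (auto simp: doubleton_eq_iff prod_eq_iff)
    finally show ?thesis .
  qed
  ultimately have sp: "step_prob x t v = (if v - p \<in> {(1, 0), (-1, 0), (0, 1), (0, -1)}
      then conductance x t {p, v} / (8 - 8 * stay xs) else 0)"
    by (simp add: step_prob_def xt)
  have nz: "8 - 8 * stay xs = 8 * (1 - stay xs)" "1 - stay xs \<noteq> 0" using stay_bounds[of xs] by auto
  have v_eq: "v - p = d \<Longrightarrow> v = p + d" for d
    by (auto simp: algebra_simps)
  have minus: "p + (-1, 0) = p - (1, 0)" "p + (0, -1) = p - (0, 1)"
    by (auto simp: prod_eq_iff)
  consider "v = p + (1, 0)" | "v = p - (1, 0)" | "v = p + (0, 1)" | "v = p - (0, 1)"
    | "v - p \<notin> {(1, 0), (-1, 0), (0, 1), (0, -1)}"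
    using v_eq[of "(1, 0)"] v_eq[of "(-1, 0)", unfolded minus] v_eq[of "(0, 1)"] v_eq[of "(0, -1)", unfolded minus]
    by blast
  then have "jump xs v = (if v - p \<in> {(1, 0), (-1, 0), (0, 1), (0, -1)}
      then conductance x t {p, v} / 8 else 0)"
  proof cases
    case 1
    then show ?thesis by (simp add: right jump_def p_def[symmetric])
  next
    case 2
    then have "v - p = (-1, 0)" by (simp add: prod_eq_iff)
    then show ?thesis unfolding 2 left by (simp add: jump_def p_def[symmetric] diff_divide_distrib)
  next
    case 3
    then show ?thesis by (simp add: vert jump_def p_def[symmetric])
  next
    case 4
    then have "v - p = (0, -1)" by (simp add: prod_eq_iff)
    then show ?thesis unfolding 4 vert by (simp add: jump_def p_def[symmetric])
  next
    case 5
    then show ?thesis by (simp add: jump_def p_def[symmetric])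
  qed
  then have "step_prob x t v = jump xs v / (1 - stay xs)"
    unfolding sp nz(1) by simp
  then show ?thesis unfolding x_def[abs_def] .
qed

section \<open>Transfer to the probability space of the MAW\<close>

context monotone_adaptive_walk
begin

definition path :: "nat \<Rightarrow> 'a \<Rightarrow> vertex list" where
  "path t \<omega> = map (\<lambda>s. X s \<omega>) (rev [0..<Suc t])"

lemma length_path [simp]: "length (path t \<omega>) = Suc t"
  by (simp add: path_def)

lemma path_Suc: "path (Suc t) \<omega> = X (Suc t) \<omega> # path t \<omega>"
  by (simp add: path_def)

lemma path_nth: "i \<le> t \<Longrightarrow> path t \<omega> ! i = X (t - i) \<omega>"
  by (simp add: path_def rev_nth del: upt_Suc)

lemma sets_X: "{\<omega> \<in> space M. X t \<omega> = v} \<in> events"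
  using measurable_sets[OF measurable_X[of t], of "{v}"]
  by (simp add: vimage_def Int_def conj_commute)

lemma path_eq_iff:
  assumes "length xs = Suc t"
  shows "path t \<omega> = xs \<longleftrightarrow> (\<forall>s\<le>t. X s \<omega> = xs ! (t - s))"
proof -
  have "path t \<omega> = xs \<longleftrightarrow> (\<forall>i\<le>t. X (t - i) \<omega> = xs ! i)"
    using assms by (auto simp: list_eq_iff_nth_eq path_nth less_Suc_eq_le)
  also have "\<dots> \<longleftrightarrow> (\<forall>s\<le>t. X s \<omega> = xs ! (t - s))"
    by (metis diff_diff_cancel diff_le_self)
  finally show ?thesis .
qed

lemma sets_path: "{\<omega> \<in> space M. path t \<omega> = xs} \<in> events"
proof (cases "length xs = Suc t")
  case True
  have "{\<omega> \<in> space M. path t \<omega> = xs} = (\<Inter>s\<in>{..t}. {\<omega> \<in> space M. X s \<omega> = xs ! (t - s)})"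
    unfolding path_eq_iff[OF True] by auto
  also have "\<dots> \<in> events"
    by (rule sets.finite_INT) (auto simp: sets_X)
  finally show ?thesis .
next
  case False
  then have "{\<omega> \<in> space M. path t \<omega> = xs} = {}" by auto
  then show ?thesis by (simp only: sets.empty_sets)
qed

lemma prob_path: "length xs = Suc t \<Longrightarrow> prob {\<omega> \<in> space M. path t \<omega> = xs} = law xs"
proof (induction t arbitrary: xs)
  case 0
  then obtain v where xs: "xs = [v]" by (cases xs) auto
  have "prob {\<omega> \<in> space M. path 0 \<omega> = xs} = prob (if v = (0, 0) then space M else {})"
    using start sets_path[of 0 xs] by (intro finite_measure_eq_AE) (auto simp: path_def xs)
  then show ?case by (simp add: xs prob_space)
next
  case (Suc t)
  then obtain v ys where xs: "xs = v # ys" and ys: "length ys = Suc t" by (cases xs) auto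
  define B where "B \<omega> \<longleftrightarrow> (\<forall>s\<le>t. X s \<omega> = ys ! (t - s))" for \<omega>
  have B: "path t \<omega> = ys \<longleftrightarrow> B \<omega>" for \<omega> using path_eq_iff[OF ys] by (simp add: B_def)
  have evB: "{\<omega> \<in> space M. B \<omega>} \<in> events" using sets_path[of t ys] by (simp add: B)
  have pB: "prob {\<omega> \<in> space M. B \<omega>} = law ys" using Suc.IH[OF ys] by (simp add: B)
  have eq: "{\<omega> \<in> space M. path (Suc t) \<omega> = xs} = {\<omega> \<in> space M. X (Suc t) \<omega> = v \<and> B \<omega>}"
    by (auto simp: xs path_Suc B)
  have law: "law xs = law ys * (jump ys v / (1 - stay ys))" using ys by (cases ys) (auto simp: xs)
  show ?case
  proof (cases "law ys = 0")
    \<comment> \<open>A null history gives no conditional law, but its extensions are null as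
      well.\<close>
    case True
    have "prob {\<omega> \<in> space M. path (Suc t) \<omega> = xs} \<le> prob {\<omega> \<in> space M. B \<omega>}"
      unfolding eq using evB by (intro finite_measure_mono) auto
    then show ?thesis using True law pB measure_nonneg[of M] by (simp add: order_antisym)
  next
    case False
    then have "law ys > 0" using pB measure_nonneg[of M "{\<omega> \<in> space M. B \<omega>}"] by simp
    then have "\<P>(\<omega> in M. X (Suc t) \<omega> = v \<bar> B \<omega>) = step_prob (\<lambda>s. ys ! (t - s)) t v"
      unfolding B_def by (intro transition) (simp add: pB[unfolded B_def])
    then have "prob {\<omega> \<in> space M. X (Suc t) \<omega> = v \<and> B \<omega>} / law ys = jump ys v / (1 - stay ys)"
      by (simp add: cond_prob_def pB step_prob_eq[OF ys])
    then show ?thesis unfolding eq law using False by (simp add: field_simps)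
  qed
qed

lemma prob_incseq_le:
  assumes "incseq A" "\<And>n. A n \<in> events" "\<And>n. prob (A n) \<le> \<epsilon>"
  shows "prob (\<Union>n. A n) \<le> \<epsilon>"
proof -
  have r: "range A \<subseteq> events" using assms(2) by blast
  have "(\<lambda>n. prob (A n)) \<longlonglongrightarrow> prob (\<Union>n. A n)"
    by (rule finite_Lim_measure_incseq[OF r assms(1)])
  then show ?thesis by (rule LIMSEQ_le_const2) (use assms(3) in blast)
qed

text \<open>The comparison with the lazy walk is available for finite sets of paths; the paths with
  m + 1 vertices in growing boxes exhaust the event.\<close>

lemma prob_visit_between:
  assumes \<epsilon>: "\<And>T. pr T (\<lambda>l. \<exists>l'. suffix l' l \<and> n \<le> length l' \<and> hd (hist l') = v) \<le> \<epsilon>"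
  shows "prob {\<omega> \<in> space M. \<exists>j\<in>{n..m}. X j \<omega> = v} \<le> \<epsilon>"
proof -
  define F where "F N = {xs. set xs \<subseteq> {- int N..int N} \<times> {- int N..int N} \<and> length xs = Suc m}
    \<inter> {xs. \<exists>i. i + n \<le> m \<and> xs ! i = v}" for N
  define A where "A N = {\<omega> \<in> space M. path m \<omega> \<in> F N}" for N
  have fin: "finite (F N)" for N
    unfolding F_def by (intro finite_Int disjI1 finite_lists_length_eq) auto
  have A: "A N = (\<Union>xs\<in>F N. {\<omega> \<in> space M. path m \<omega> = xs})" for N
    by (auto simp: A_def)
  have ev: "A N \<in> events" for N
    unfolding A using fin sets_path by (intro sets.finite_UN) auto
  have "prob (A N) \<le> \<epsilon>" for N
  proof -
    have "prob (A N) = (\<Sum>xs\<in>F N. prob {\<omega> \<in> space M. path m \<omega> = xs})"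
      unfolding A using fin sets_path
      by (intro finite_measure_finite_Union) (auto simp: disjoint_family_on_def)
    also have "\<dots> = (\<Sum>xs\<in>F N. law xs)"
      by (intro sum.cong prob_path) (auto simp: F_def)
    also have "\<dots> \<le> \<epsilon>"
      by (rule sum_law_late_visit_le[OF \<epsilon> fin]) (auto simp: F_def)
    finally show ?thesis .
  qed
  moreover have "incseq A"
    unfolding incseq_def A_def F_def by force
  ultimately have "prob (\<Union>N. A N) \<le> \<epsilon>" using ev by (intro prob_incseq_le) auto
  moreover have "(\<Union>N. A N) = {\<omega> \<in> space M. \<exists>j\<in>{n..m}. X j \<omega> = v}"
  proof (intro equalityI subsetI)
    fix \<omega> assume "\<omega> \<in> (\<Union>N. A N)"
    then obtain i where i: "\<omega> \<in> space M" "i + n \<le> m" "path m \<omega> ! i = v"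
      by (auto simp: A_def F_def)
    then have "X (m - i) \<omega> = v" "m - i \<in> {n..m}" using path_nth[of i m \<omega>] by auto
    then show "\<omega> \<in> {\<omega> \<in> space M. \<exists>j\<in>{n..m}. X j \<omega> = v}" using i by blast
  next
    fix \<omega> assume "\<omega> \<in> {\<omega> \<in> space M. \<exists>j\<in>{n..m}. X j \<omega> = v}"
    then obtain j where j: "\<omega> \<in> space M" "n \<le> j" "j \<le> m" "X j \<omega> = v" by auto
    define S where "S = set (path m \<omega>)"
    define N where "N = nat (Max ((\<lambda>z. max \<bar>fst z\<bar> \<bar>snd z\<bar>) ` S))"
    have "max \<bar>fst z\<bar> \<bar>snd z\<bar> \<le> int N" if "z \<in> S" for z
    proof -
      have "max \<bar>fst z\<bar> \<bar>snd z\<bar> \<le> Max ((\<lambda>z. max \<bar>fst z\<bar> \<bar>snd z\<bar>) ` S)"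
        using that by (intro Max_ge) (auto simp: S_def)
      then show ?thesis unfolding N_def by linarith
    qed
    then have "S \<subseteq> {- int N..int N} \<times> {- int N..int N}" by (fastforce simp: abs_le_iff)
    moreover have "m - j + n \<le> m" "path m \<omega> ! (m - j) = v" using j by (auto simp: path_nth)
    ultimately have "path m \<omega> \<in> F N" unfolding F_def S_def by auto
    then show "\<omega> \<in> (\<Union>N. A N)" using j by (auto simp: A_def)
  qed
  ultimately show ?thesis by simp
qed

lemma AE_finite_visits: "AE \<omega> in M. finite {t. X t \<omega> = v}"
proof -
  define I where "I = {\<omega> \<in> space M. \<forall>n. \<exists>j\<ge>n. X j \<omega> = v}"
  have "I = (\<Inter>n. \<Union>j\<in>{n..}. {\<omega> \<in> space M. X j \<omega> = v})"
    by (auto simp: I_def)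
  moreover have "(\<Union>j\<in>{n..}. {\<omega> \<in> space M. X j \<omega> = v}) \<in> events" for n
    by (rule sets.countable_UN) (auto simp: sets_X)
  then have "(\<Inter>n. \<Union>j\<in>{n..}. {\<omega> \<in> space M. X j \<omega> = v}) \<in> events"
    by (intro sets.countable_INT) auto
  ultimately have evI: "I \<in> events" by simp
  have ev: "{\<omega> \<in> space M. \<exists>j\<in>{n..m}. X j \<omega> = v} \<in> events" for n m
  proof -
    have "{\<omega> \<in> space M. \<exists>j\<in>{n..m}. X j \<omega> = v} = (\<Union>j\<in>{n..m}. {\<omega> \<in> space M. X j \<omega> = v})"
      by auto
    then show ?thesis by (simp add: sets.finite_UN sets_X)
  qed
  have "prob I \<le> \<epsilon>" if pos: "\<epsilon> > 0" for \<epsilon>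
  proof -
    obtain n where n: "\<And>T. pr T (\<lambda>l. \<exists>l'. suffix l' l \<and> n \<le> length l' \<and> hd (hist l') = v) \<le> \<epsilon>"
      using late_visits_unlikely[OF pos, of v] by blast
    have "prob I \<le> prob (\<Union>m. {\<omega> \<in> space M. \<exists>j\<in>{n..m}. X j \<omega> = v})"
    proof (rule finite_measure_mono)
      show "I \<subseteq> (\<Union>m. {\<omega> \<in> space M. \<exists>j\<in>{n..m}. X j \<omega> = v})"
        unfolding I_def by (force intro: order_refl)
    qed (intro sets.countable_UN, use ev in auto)
    also have "\<dots> \<le> \<epsilon>"
      using prob_visit_between[OF n] ev by (intro prob_incseq_le) (force simp: incseq_def)+
    finally show ?thesis .
  qed
  then have "prob I \<le> 0" by - (rule field_le_epsilon, simp)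
  then have "prob I = 0" using measure_nonneg[of M I] by (rule antisym)
  then have "AE \<omega> in M. \<omega> \<notin> I" using evI by (simp add: prob_eq_0)
  then show ?thesis
  proof (rule AE_mp, intro AE_I2 impI)
    fix \<omega> assume "\<omega> \<in> space M" "\<omega> \<notin> I"
    then obtain n where "\<And>j. j \<ge> n \<Longrightarrow> X j \<omega> \<noteq> v" by (auto simp: I_def)
    then have "{t. X t \<omega> = v} \<subseteq> {..<n}" using leI by blast
    then show "finite {t. X t \<omega> = v}" by (rule finite_subset) simp
  qed
qed

end

theorem theorem6p1:
  fixes M :: "'a measure" and X :: "nat \<Rightarrow> 'a \<Rightarrow> int \<times> int"
  assumes "monotone_adaptive_walk M X"
  shows "AE \<omega> in M. \<forall>v. finite {t. X t \<omega> = v}"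
proof -
  interpret monotone_adaptive_walk M X by fact
  show ?thesis unfolding AE_all_countable using AE_finite_visits by blast
qed

end
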